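(* Let $\Gamma$ be a countable set, let $\{X_\gamma\}_{\gamma\in\Gamma}$ be a family of Banach spaces, and let $\mathcal{E}$ be a Banach sequence space on $\Gamma$ with the property $\mathbf{H}(\textit{point-wise})$. Suppose that $\mathcal{E}$ is monotone complete. Then the space $(\bigoplus_{\gamma\in\Gamma}X_\gamma)_{\mathcal{E}}$ has the property $\mathbf{H}(\textit{weak})$ if, and only if, (1) all the spaces $X_\gamma$ have the property $\mathbf{H}(\textit{weak})$; and (2) the set $\Gamma$ can be decomposed into two disjoint subsets $\Gamma_1$ and $\Gamma_2$ such that every $X_\gamma$ with $\gamma\in\Gamma_1$ has the Schur property and $\mathcal{E}$ is $\mathbf{SM}(\gamma)$ for every $\gamma\in\Gamma_2$.
   Context: Conventions: unless stated otherwise, Banach spaces are real and infinite-dimensional. Banach sequence space on a countable set $\Gamma$: a Banach space $X$ that is a linear subspace of the space $\omega(\Gamma)$ of all real functions on $\Gamma$, contains the characteristic functions of all finite subsets of $\Gamma$, and has the ideal property: if $|x(\gamma)|\le|y(\gamma)|$ for all $\gamma\in\Gamma$ and $y\in X$, then $x\in X$ and $\|x\|\le\|y\|$. $X_+$ denotes the nonnegative elements of $X$; $\boldsymbol{e}_\gamma$ is the $\gamma$-th unit vector. Monotone complete: every increasing sequence $\{x_n\}$ of positive functions from the closed unit ball $\mathrm{Ball}(X)$ converges point-wise to some $x\in X$. Direct sum: $(\bigoplus_{\gamma\in\Gamma}X_\gamma)_{\mathcal{E}}$ is the Banach space of all $x=\{x(\gamma)\}_{\gamma\in\Gamma}\in\prod_{\gamma}X_\gamma$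 with $\sum_{\gamma}\|x(\gamma)\|_{X_\gamma}\boldsymbol{e}_\gamma\in\mathcal{E}$, with coordinate-wise operations and norm $\|x\|=\big\|\sum_{\gamma}\|x(\gamma)\|_{X_\gamma}\boldsymbol{e}_\gamma\big\|_{\mathcal{E}}$. Kadets--Klee property: for a linear Hausdorff topology $\mathfrak{T}$ on a Banach space $X$ coarser (not necessarily strictly) than the norm topology, $X$ has $\mathbf{H}(\mathfrak{T})$ if whenever $x_n,x$ lie on the unit sphere of $X$ and $x_n\to x$ in $\mathfrak{T}$, then $\|x_n-x\|\to0$. $\mathbf{H}(\textit{weak})$ and $\mathbf{H}(\textit{point-wise})$ refer to the weak topology and (on Banach sequence spaces) the topology of point-wise convergence. Schur property: every weakly convergent sequence is norm convergent. $\mathbf{SM}(\gamma_0)$: a Banach sequence space $X$ on $\Gamma$ is $\mathbf{SM}(\gamma_0)$ if for all $x,y\in X_+$ with $x(\gamma)\le y(\gamma)$ for $\gamma\ne\gamma_0$ and $x(\gamma_0)<y(\gamma_0)$ one has $\|x\|<\|y\|$. *)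

theory Defs
  imports "HOL-Analysis.Analysis" "HOL-Library.Function_Algebras"
begin

section \<open>Pointwise real vector space structure on functions\<close>

instantiation "fun" :: (type, real_vector) real_vector
begin

definition scaleR_fun :: "real \<Rightarrow> ('a \<Rightarrow> 'b) \<Rightarrow> 'a \<Rightarrow> 'b"
  where "c *\<^sub>R f = (\<lambda>x. c *\<^sub>R f x)"

instance
  by standard (simp_all add: scaleR_fun_def fun_eq_iff scaleR_add_right scaleR_add_left)

end

lemma scaleR_fun_apply [simp]: "(c *\<^sub>R f) x = c *\<^sub>R f x"
  by (simp add: scaleR_fun_def)


section \<open>Banach spaces as subspaces with their own norm\<close>

text \<open>
  The members of a family of Banach spaces, a sequence space and a direct sum all carry norms that
  are not determined by a type. A normed space is therefore a linear subspace of some ambient real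
  vector space (a type of class \<^class>\<open>real_vector\<close>) together with a norm function, whose values
  outside the subspace are irrelevant. The ambient space itself has no norm or topology, so up to
  linear isometry this covers every family of normed spaces: embed the family, say, in its
  algebraic direct sum.
\<close>

record 'a nspace =
  vecs :: "'a set"
  nrm :: "'a \<Rightarrow> real"

definition normed_space :: "('a::real_vector) nspace \<Rightarrow> bool" where
  "normed_space V \<longleftrightarrow>
     subspace (vecs V) \<and>
     (\<forall>x\<in>vecs V. 0 \<le> nrm V x) \<and>
     (\<forall>x\<in>vecs V. nrm V x = 0 \<longleftrightarrow> x = 0) \<and>
     (\<forall>c. \<forall>x\<in>vecs V. nrm V (c *\<^sub>R x) = \<bar>c\<bar> * nrm V x) \<and>
     (\<forall>x\<in>vecs V. \<forall>y\<in>vecs V. nrm V (x + y) \<le> nrm V x + nrm V y)"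

text \<open>The value 0 outside the subspace is needed because the locale \<^locale>\<open>Metric_space\<close> asks for
  nonnegativity and symmetry on the whole type.\<close>

definition ndist :: "('a::real_vector) nspace \<Rightarrow> 'a \<Rightarrow> 'a \<Rightarrow> real" where
  "ndist V x y = (if x \<in> vecs V \<and> y \<in> vecs V then nrm V (x - y) else 0)"

definition banach_space :: "('a::real_vector) nspace \<Rightarrow> bool" where
  "banach_space V \<longleftrightarrow> normed_space V \<and> Metric_space.mcomplete (vecs V) (ndist V)"

definition infinite_dimensional :: "('a::real_vector) nspace \<Rightarrow> bool" where
  "infinite_dimensional V \<longleftrightarrow> \<not> (\<exists>B. finite B \<and> span B = vecs V)"

definition norm_topology :: "('a::real_vector) nspace \<Rightarrow> 'a topology" where
  "norm_topology V = Metric_space.mtopology (vecs V) (ndist V)"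

definition dual :: "('a::real_vector) nspace \<Rightarrow> ('a \<Rightarrow> real) set" where
  "dual V = {f. (\<forall>x\<in>vecs V. \<forall>y\<in>vecs V. f (x + y) = f x + f y) \<and>
                (\<forall>c. \<forall>x\<in>vecs V. f (c *\<^sub>R x) = c * f x) \<and>
                (\<exists>C. \<forall>x\<in>vecs V. \<bar>f x\<bar> \<le> C * nrm V x)}"

definition weak_topology :: "('a::real_vector) nspace \<Rightarrow> 'a topology" where
  "weak_topology V =
     topology_generated_by {{x \<in> vecs V. f x \<in> U} | f U. f \<in> dual V \<and> open U}"

text \<open>The property H(T), to be used for linear Hausdorff topologies T on the space that are coarser
  than its norm topology; the weak and the pointwise topology below are such.\<close>

definition kadets_klee :: "('a::real_vector) nspace \<Rightarrow> 'a topology \<Rightarrow> bool" where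
  "kadets_klee V T \<longleftrightarrow>
     (\<forall>x l. (\<forall>n. x n \<in> vecs V \<and> nrm V (x n) = 1) \<and> l \<in> vecs V \<and> nrm V l = 1 \<and>
            limitin T x l sequentially
        \<longrightarrow> (\<lambda>n. nrm V (x n - l)) \<longlonglongrightarrow> 0)"

definition schur_property :: "('a::real_vector) nspace \<Rightarrow> bool" where
  "schur_property V \<longleftrightarrow>
     (\<forall>x. (\<forall>n. x n \<in> vecs V) \<and> (\<exists>l. limitin (weak_topology V) x l sequentially)
        \<longrightarrow> (\<exists>l. limitin (norm_topology V) x l sequentially))"


section \<open>Banach sequence spaces\<close>

text \<open>Real functions on a set \<open>\<Gamma>\<close> are represented by functions on the whole type that vanish
  outside \<open>\<Gamma>\<close>.\<close>

definition omega :: "'g set \<Rightarrow> ('g \<Rightarrow> real) set" where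
  "omega \<Gamma> = {x. \<forall>\<gamma>. \<gamma> \<notin> \<Gamma> \<longrightarrow> x \<gamma> = 0}"

definition banach_sequence_space :: "'g set \<Rightarrow> ('g \<Rightarrow> real) nspace \<Rightarrow> bool" where
  "banach_sequence_space \<Gamma> E \<longleftrightarrow>
     banach_space E \<and>
     vecs E \<subseteq> omega \<Gamma> \<and>
     (\<forall>F. finite F \<and> F \<subseteq> \<Gamma> \<longrightarrow> indicator F \<in> vecs E) \<and>
     (\<forall>x\<in>omega \<Gamma>. \<forall>y\<in>vecs E.
        (\<forall>\<gamma>\<in>\<Gamma>. \<bar>x \<gamma>\<bar> \<le> \<bar>y \<gamma>\<bar>) \<longrightarrow> x \<in> vecs E \<and> nrm E x \<le> nrm E y)"

definition positive_cone :: "'g set \<Rightarrow> ('g \<Rightarrow> real) nspace \<Rightarrow> ('g \<Rightarrow> real) set" where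
  "positive_cone \<Gamma> E = {x \<in> vecs E. \<forall>\<gamma>\<in>\<Gamma>. 0 \<le> x \<gamma>}"

text \<open>The library topology on \<^typ>\<open>'g \<Rightarrow> real\<close> is the product topology; coordinates outside the
  index set do not matter here because they are constantly 0.\<close>

definition pointwise_topology :: "('g \<Rightarrow> real) nspace \<Rightarrow> ('g \<Rightarrow> real) topology" where
  "pointwise_topology E = top_of_set (vecs E)"

definition monotone_complete :: "'g set \<Rightarrow> ('g \<Rightarrow> real) nspace \<Rightarrow> bool" where
  "monotone_complete \<Gamma> E \<longleftrightarrow>
     (\<forall>x. (\<forall>n. x n \<in> positive_cone \<Gamma> E \<and> nrm E (x n) \<le> 1) \<and>
          (\<forall>n. \<forall>\<gamma>\<in>\<Gamma>. x n \<gamma> \<le> x (Suc n) \<gamma>)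
        \<longrightarrow> (\<exists>l\<in>vecs E. \<forall>\<gamma>\<in>\<Gamma>. (\<lambda>n. x n \<gamma>) \<longlonglongrightarrow> l \<gamma>))"

definition SM :: "'g set \<Rightarrow> ('g \<Rightarrow> real) nspace \<Rightarrow> 'g \<Rightarrow> bool" where
  "SM \<Gamma> E \<gamma>\<^sub>0 \<longleftrightarrow>
     (\<forall>x\<in>positive_cone \<Gamma> E. \<forall>y\<in>positive_cone \<Gamma> E.
        (\<forall>\<gamma>\<in>\<Gamma>. \<gamma> \<noteq> \<gamma>\<^sub>0 \<longrightarrow> x \<gamma> \<le> y \<gamma>) \<and> x \<gamma>\<^sub>0 < y \<gamma>\<^sub>0 \<longrightarrow> nrm E x < nrm E y)"


section \<open>Direct sums\<close>

definition norm_fun :: "'g set \<Rightarrow> ('g \<Rightarrow> 'b nspace) \<Rightarrow> ('g \<Rightarrow> 'b) \<Rightarrow> 'g \<Rightarrow> real" where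
  "norm_fun \<Gamma> X x = (\<lambda>\<gamma>. if \<gamma> \<in> \<Gamma> then nrm (X \<gamma>) (x \<gamma>) else 0)"

definition direct_sum ::
    "'g set \<Rightarrow> ('g \<Rightarrow> ('b::real_vector) nspace) \<Rightarrow> ('g \<Rightarrow> real) nspace \<Rightarrow> ('g \<Rightarrow> 'b) nspace" where
  "direct_sum \<Gamma> X E =
     \<lparr>vecs = {x. (\<forall>\<gamma>\<in>\<Gamma>. x \<gamma> \<in> vecs (X \<gamma>)) \<and> (\<forall>\<gamma>. \<gamma> \<notin> \<Gamma> \<longrightarrow> x \<gamma> = 0) \<and>
                 norm_fun \<Gamma> X x \<in> vecs E},
      nrm = (\<lambda>x. nrm E (norm_fun \<Gamma> X x))\<rparr>"

end

theory Submission
  imports Defs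
begin

text \<open>
  Write \<open>D\<close> for the direct sum, \<open>|x|\<close> for the function \<open>\<gamma> \<mapsto> \<parallel>x(\<gamma>)\<parallel>\<close> (so \<open>\<parallel>x\<parallel> = \<parallel>|x|\<parallel>\<close>, the right-hand norm
  being that of \<open>E\<close>), and \<open>e\<^sub>\<gamma>\<close> for the unit vectors. A functional on a summand becomes one on \<open>D\<close>
  through the coordinate map, and a functional on \<open>D\<close> restricts to every summand. So weak
  convergence in \<open>D\<close> implies weak convergence of the coordinates, and a sequence that moves in only
  one coordinate converges weakly in \<open>D\<close> if that coordinate does.

  Order continuity. The property H(point-wise) forces \<open>\<parallel>x 1\<^bsub>\<Gamma> - F\<^esub>\<parallel> \<rightarrow> 0\<close> as \<open>F\<close> grows through the finite
  subsets of \<open>\<Gamma>\<close>, for every \<open>x\<close> in \<open>E\<close>. If this fails, completeness of \<open>E\<close> yields a \<open>\<delta> > 0\<close> such that finite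
  blocks \<open>G\<close> with \<open>\<parallel>x 1\<^sub>G\<parallel> \<ge> \<delta>\<close> exist beyond every finite set. Blocks \<open>G\<^sub>0, G\<^sub>1, \<dots>\<close> with union \<open>U\<close> can be
  chosen so that \<open>\<parallel>x 1\<^bsub>U - G\<^sub>n\<^esub>\<parallel> \<rightarrow> \<parallel>x 1\<^sub>U\<parallel>\<close>. The functions \<open>x 1\<^bsub>U - G\<^sub>n\<^esub>\<close> tend to \<open>x 1\<^sub>U\<close> point-wise but
  stay at distance at least \<open>\<delta>\<close> from it, contradicting H(point-wise)
  (\<open>kadets_klee_pointwise_imp_cauchy\<close>, \<open>kadets_klee_pointwise_imp_order_continuous\<close>).

  Necessity. Each summand embeds isometrically, up to the factor \<open>\<parallel>e\<^sub>\<gamma>\<parallel>\<close>, and so inherits H(weak).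
  Suppose that \<open>X\<^sub>\<gamma>\<close> is not Schur and \<open>E\<close> is not SM(\<open>\<gamma>\<close>). The former gives unit vectors \<open>w\<^sub>n \<rightarrow> 0\<close>
  weakly in \<open>X\<^sub>\<gamma>\<close>; the latter gives \<open>x \<ge> 0\<close> and \<open>s > 0\<close> with \<open>\<parallel>x + s e\<^sub>\<gamma>\<parallel> = \<parallel>x\<parallel>\<close>. Take \<open>z\<close> in \<open>D\<close> with
  \<open>|z| = x\<close> and add \<open>\<plusminus> s w\<^sub>n\<close> to its coordinate at \<open>\<gamma>\<close>, with the sign that does not decrease the norm of that
  coordinate. All vectors obtained have the norm of \<open>z\<close> and they tend to \<open>z\<close> weakly, at the constant
  distance \<open>s \<parallel>e\<^sub>\<gamma>\<parallel>\<close> (\<open>kadets_klee_direct_sum_imp_schur_or_SM\<close>).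

  Sufficiency. Let \<open>x\<^sub>n \<rightarrow> x\<close> weakly on the unit sphere of \<open>D\<close>. It suffices that \<open>|x\<^sub>n| \<rightarrow> |x|\<close> point-wise:
  then H(point-wise) gives \<open>\<parallel>|x\<^sub>n| - |x|\<parallel> \<rightarrow> 0\<close>, H(weak) of the summands gives convergence in norm of each
  coordinate, and \<open>|x\<^sub>n - x| \<le> ||x\<^sub>n| - |x|| + 2|x|\<close>, with the outer bars of \<open>||x\<^sub>n| - |x||\<close> the absolute
  value of a real function, together with order continuity gives \<open>\<parallel>x\<^sub>n - x\<parallel> \<rightarrow> 0\<close>
  (\<open>dominated_pointwise_null_imp_norm_null\<close>). At a Schur coordinate point-wise convergence is clear.
  At the others weak lower semicontinuity of the norm (from the Hahn--Banach theorem,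
  \<open>norming_functional\<close>) bounds \<open>\<parallel>x\<^sub>n(\<gamma>)\<parallel>\<close> from below in the limit. If \<open>\<parallel>x\<^sub>n(\<gamma>)\<parallel>\<close> exceeded \<open>\<parallel>x(\<gamma>)\<parallel>\<close> by a fixed
  \<open>\<epsilon> > 0\<close> infinitely often, then \<open>|x| + \<epsilon> e\<^sub>\<gamma>\<close> would have norm at most 1 = \<open>\<parallel>|x|\<parallel>\<close>, which SM(\<open>\<gamma>\<close>) forbids
  (\<open>SM_imp_coordinate_convergence\<close>).
\<close>

section \<open>Normed spaces carried by subspaces\<close>

lemma nspace_subspace: "normed_space V \<Longrightarrow> subspace (vecs V)"
  by (simp add: normed_space_def)

lemma nrm_nonneg: "normed_space V \<Longrightarrow> x \<in> vecs V \<Longrightarrow> 0 \<le> nrm V x"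
  by (simp add: normed_space_def)

lemma nrm_eq_0_iff: "normed_space V \<Longrightarrow> x \<in> vecs V \<Longrightarrow> nrm V x = 0 \<longleftrightarrow> x = 0"
  by (simp add: normed_space_def)

lemma nrm_scale: "normed_space V \<Longrightarrow> x \<in> vecs V \<Longrightarrow> nrm V (c *\<^sub>R x) = \<bar>c\<bar> * nrm V x"
  by (simp add: normed_space_def)

lemma nrm_triangle:
  "normed_space V \<Longrightarrow> x \<in> vecs V \<Longrightarrow> y \<in> vecs V \<Longrightarrow> nrm V (x + y) \<le> nrm V x + nrm V y"
  by (simp add: normed_space_def)

lemma nspace_zero: "normed_space V \<Longrightarrow> 0 \<in> vecs V"
  by (simp add: nspace_subspace subspace_0)

lemma nspace_add: "normed_space V \<Longrightarrow> x \<in> vecs V \<Longrightarrow> y \<in> vecs V \<Longrightarrow> x + y \<in> vecs V"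
  by (simp add: nspace_subspace subspace_add)

lemma nspace_diff: "normed_space V \<Longrightarrow> x \<in> vecs V \<Longrightarrow> y \<in> vecs V \<Longrightarrow> x - y \<in> vecs V"
  by (simp add: nspace_subspace subspace_diff)

lemma nspace_scale: "normed_space V \<Longrightarrow> x \<in> vecs V \<Longrightarrow> c *\<^sub>R x \<in> vecs V"
  by (simp add: nspace_subspace subspace_scale)

lemmas nspace_closed = nspace_zero nspace_add nspace_diff nspace_scale

lemma nrm_zero: "normed_space V \<Longrightarrow> nrm V 0 = 0"
  by (simp add: nrm_eq_0_iff nspace_zero)

lemma nrm_minus_commute:
  assumes "normed_space V" "x \<in> vecs V" "y \<in> vecs V"
  shows "nrm V (x - y) = nrm V (y - x)"
  using nrm_scale[OF assms(1) nspace_diff[OF assms(1,2,3)], of "-1"] by simp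

lemma nrm_triangle_diff:
  assumes "normed_space V" "x \<in> vecs V" "y \<in> vecs V"
  shows "nrm V x - nrm V y \<le> nrm V (x - y)"
  using nrm_triangle[OF assms(1) nspace_diff[OF assms] assms(3)] by simp

lemma infinite_dimensional_imp_nontrivial:
  assumes "normed_space V" "infinite_dimensional V"
  shows "\<exists>v\<in>vecs V. v \<noteq> 0"
proof (rule ccontr)
  assume "\<not> ?thesis"
  then have "vecs V = span {}" using nspace_zero[OF assms(1)] by auto
  then show False using assms(2) unfolding infinite_dimensional_def by blast
qed

lemma metric_space_ndist:
  assumes ns: "normed_space V"
  shows "Metric_space (vecs V) (ndist V)"
proof
  fix x y show "0 \<le> ndist V x y" by (simp add: ndist_def nrm_nonneg[OF ns] nspace_diff[OF ns])
  show "ndist V x y = ndist V y x" by (simp add: ndist_def nrm_minus_commute[OF ns])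
next
  fix x y assume "x \<in> vecs V" "y \<in> vecs V"
  then show "ndist V x y = 0 \<longleftrightarrow> x = y"
    by (simp add: ndist_def nrm_eq_0_iff[OF ns] nspace_diff[OF ns])
next
  fix x y z assume "x \<in> vecs V" "y \<in> vecs V" "z \<in> vecs V"
  then show "ndist V x z \<le> ndist V x y + ndist V y z"
    using nrm_triangle[OF ns, of "x - y" "y - z"] by (simp add: ndist_def nspace_diff[OF ns])
qed

lemma limitin_norm_topology_iff:
  assumes ns: "normed_space V" and x: "\<And>n. x n \<in> vecs V" and l: "l \<in> vecs V"
  shows "limitin (norm_topology V) x l sequentially \<longleftrightarrow> (\<lambda>n. nrm V (x n - l)) \<longlonglongrightarrow> 0"
proof -
  interpret Metric_space "vecs V" "ndist V" by (rule metric_space_ndist[OF ns])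
  show ?thesis
    unfolding norm_topology_def limitin_metric tendsto_iff
    using x l by (simp add: ndist_def nrm_nonneg[OF ns] nspace_diff[OF ns])
qed

section \<open>Norming functionals\<close>

definition sublinear_on :: "'a::real_vector set \<Rightarrow> ('a \<Rightarrow> real) \<Rightarrow> bool" where
  "sublinear_on S q \<longleftrightarrow>
     (\<forall>x\<in>S. \<forall>y\<in>S. q (x + y) \<le> q x + q y) \<and> (\<forall>c>0. \<forall>x\<in>S. q (c *\<^sub>R x) = c * q x)"

lemma sublinear_on_lower_bound:
  assumes S: "subspace S" and q: "sublinear_on S q" and x: "x \<in> S"
  shows "q 0 = 0" "0 \<le> q x + q (- x)"
proof -
  have "q (2 *\<^sub>R 0) = 2 * q 0"
    using q subspace_0[OF S] unfolding sublinear_on_def by (metis zero_less_numeral)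
  then show 0: "q 0 = 0" by simp
  show "0 \<le> q x + q (- x)"
    using q x subspace_neg[OF S x] 0 unfolding sublinear_on_def by (metis add.right_inverse)
qed

text \<open>
  The largest sublinear functional below \<open>q\<close> whose value at \<open>-y\<close> is at most \<open>-q y\<close>, so that its
  value at \<open>y\<close> remains \<open>q y\<close>. It is used twice: it shows that a minimal sublinear functional is
  additive, and, applied to a norm, it forces the linear functional found below it to attain the
  norm at \<open>y\<close>.
\<close>
lemma sublinear_on_directional:
  assumes S: "subspace S" and q: "sublinear_on S q" and y: "y \<in> S"
  defines "q' \<equiv> \<lambda>x. if x \<in> S then INF t\<in>{0..}. q (x + t *\<^sub>R y) - t * q y else 0"
  shows "sublinear_on S q'" "\<And>x t. x \<in> S \<Longrightarrow> 0 \<le> t \<Longrightarrow> q' x \<le> q (x + t *\<^sub>R y) - t * q y"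
proof -
  have mem: "x + t *\<^sub>R y \<in> S" if "x \<in> S" for x t
    using S y that by (simp add: subspace_add subspace_scale)
  have qs: "q (a + b) \<le> q a + q b" if "a \<in> S" "b \<in> S" for a b
    using q that by (simp add: sublinear_on_def)
  have qc: "q (c *\<^sub>R a) = c * q a" if "a \<in> S" "0 \<le> c" for a c
    using q that sublinear_on_lower_bound(1)[OF S q y] unfolding sublinear_on_def
    by (cases "c = 0") auto
  have lower: "- q (- x) \<le> q (x + t *\<^sub>R y) - t * q y" if "x \<in> S" "0 \<le> t" for x t
    using qs[OF mem[OF that(1), of t] subspace_neg[OF S that(1)]] qc[OF y that(2)] by simp
  have bdd: "bdd_below ((\<lambda>t. q (x + t *\<^sub>R y) - t * q y) ` {0..})" if "x \<in> S" for x
    using lower[OF that] by (intro bdd_belowI2[where m = "- q (- x)"]) auto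
  show le: "q' x \<le> q (x + t *\<^sub>R y) - t * q y" if "x \<in> S" "0 \<le> t" for x t
    using that bdd[OF that(1)] by (auto simp: q'_def intro: cINF_lower)
  have ge: "m \<le> q' x" if "x \<in> S" "\<And>t. 0 \<le> t \<Longrightarrow> m \<le> q (x + t *\<^sub>R y) - t * q y" for x m
    using that by (auto simp: q'_def intro: cINF_greatest)
  have scale: "c * q' x \<le> q' (c *\<^sub>R x)" if "0 < c" "x \<in> S" for c x
  proof (rule ge)
    show "c *\<^sub>R x \<in> S" using S that by (simp add: subspace_scale)
    fix t :: real assume "0 \<le> t"
    then have "c * q' x \<le> c * (q (x + (t / c) *\<^sub>R y) - t / c * q y)"
      using le[OF that(2), of "t / c"] that by (intro mult_left_mono) auto
    also have "\<dots> = q (c *\<^sub>R x + t *\<^sub>R y) - t * q y"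
      using qc[OF mem[OF that(2), of "t / c"], of c] that by (simp add: algebra_simps)
    finally show "c * q' x \<le> q (c *\<^sub>R x + t *\<^sub>R y) - t * q y" .
  qed
  show "sublinear_on S q'"
    unfolding sublinear_on_def
  proof (intro conjI ballI allI impI)
    fix a b assume a: "a \<in> S" and b: "b \<in> S"
    have "q' (a + b) - (q (b + t *\<^sub>R y) - t * q y) \<le> q' a" if "0 \<le> t" for t
    proof (rule ge[OF a])
      fix s :: real assume "0 \<le> s"
      have "q' (a + b) \<le> q (a + b + (s + t) *\<^sub>R y) - (s + t) * q y"
        using le[of "a + b" "s + t"] a b S \<open>0 \<le> s\<close> \<open>0 \<le> t\<close> by (simp add: subspace_add)
      also have "a + b + (s + t) *\<^sub>R y = (a + s *\<^sub>R y) + (b + t *\<^sub>R y)"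
        by (simp add: algebra_simps)
      finally show "q' (a + b) - (q (b + t *\<^sub>R y) - t * q y) \<le> q (a + s *\<^sub>R y) - s * q y"
        using qs[OF mem[OF a, of s] mem[OF b, of t]] by (simp add: algebra_simps)
    qed
    then have "q' (a + b) - q' a \<le> q' b"
      by (intro ge[OF b]) (simp add: algebra_simps)
    then show "q' (a + b) \<le> q' a + q' b" by simp
  next
    fix c :: real and x assume c: "0 < c" and x: "x \<in> S"
    have "inverse c * q' (c *\<^sub>R x) \<le> q' x"
      using scale[of "inverse c" "c *\<^sub>R x"] c x S by (simp add: subspace_scale)
    then have "q' (c *\<^sub>R x) \<le> c * q' x"
      using c by (simp add: field_simps)
    then show "q' (c *\<^sub>R x) = c * q' x" using scale[OF c x] by simp
  qed
qed

text \<open>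
  Zorn's lemma applies because the point-wise infimum \<open>u\<close> of a chain is again sublinear:
  \<open>- p (- x) \<le> f x\<close> bounds the chain from below, and subadditivity survives because any two members
  \<open>f\<close> and \<open>g\<close> of the chain lie above a common member.
\<close>
lemma exists_minimal_sublinear:
  assumes S: "subspace S" and p: "sublinear_on S p"
  obtains q where "sublinear_on S q" "\<And>x. x \<in> S \<Longrightarrow> q x \<le> p x"
    "\<And>q' x. sublinear_on S q' \<Longrightarrow> (\<And>z. z \<in> S \<Longrightarrow> q' z \<le> q z) \<Longrightarrow> x \<in> S \<Longrightarrow> q' x = q x"
proof -
  \<comment> \<open>Values off \<open>S\<close> are fixed to be 0, so that the point-wise order is antisymmetric on \<open>Q\<close>.\<close>
  define Q where "Q = {q. sublinear_on S q \<and> (\<forall>x\<in>S. q x \<le> p x) \<and> (\<forall>x. x \<notin> S \<longrightarrow> q x = 0)}"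
  have cut: "sublinear_on S (\<lambda>x. if x \<in> S then q x else 0)" if "sublinear_on S q" for q
    using that S by (auto simp: sublinear_on_def subspace_add subspace_scale)
  have "\<exists>m\<in>Q. \<forall>a\<in>Q. m \<ge> a \<longrightarrow> a = m"
  proof (rule predicate_Zorn)
    show "partial_order_on Q (relation_of (\<ge>) Q)"
      by (rule partial_order_on_relation_ofI) auto
    fix C assume "C \<in> Chains (relation_of (\<ge>) Q)"
    then have CQ: "C \<subseteq> Q" and chain: "\<And>f g. f \<in> C \<Longrightarrow> g \<in> C \<Longrightarrow> f \<le> g \<or> g \<le> f"
      by (auto simp: Chains_def relation_of_def)
    show "\<exists>u\<in>Q. \<forall>a\<in>C. a \<ge> u"
    proof (cases "C = {}")
      case True
      have "(\<lambda>x. if x \<in> S then p x else 0) \<in> Q"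
        using cut[OF p] by (simp add: Q_def)
      then show ?thesis using True by blast
    next
      case False
      define u where "u = (\<lambda>x. if x \<in> S then INF f\<in>C. f x else 0)"
      have lower: "- p (- x) \<le> f x" if "f \<in> C" "x \<in> S" for f x
      proof -
        have "sublinear_on S f" "f (- x) \<le> p (- x)"
          using CQ that subspace_neg[OF S that(2)] by (auto simp: Q_def)
        then show ?thesis using sublinear_on_lower_bound(2)[OF S _ that(2)] by fastforce
      qed
      have le: "u x \<le> f x" if "f \<in> C" "x \<in> S" for f x
        using that lower
        by (auto simp: u_def intro!: cINF_lower bdd_belowI2[where m = "- p (- x)"])
      have ge: "m \<le> u x" if "x \<in> S" "\<And>f. f \<in> C \<Longrightarrow> m \<le> f x" for m x
        using that False by (auto simp: u_def intro: cINF_greatest)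
      have sub: "f (a + b) \<le> f a + f b" if "f \<in> C" "a \<in> S" "b \<in> S" for f a b
        using CQ that by (auto simp: Q_def sublinear_on_def)
      have hom: "f (c *\<^sub>R a) = c * f a" if "f \<in> C" "a \<in> S" "0 < c" for f a c
        using CQ that by (auto simp: Q_def sublinear_on_def)
      have scale: "c * u x \<le> u (c *\<^sub>R x)" if "0 < c" "x \<in> S" for c x
      proof (rule ge)
        show "c *\<^sub>R x \<in> S" using S that(2) by (simp add: subspace_scale)
        fix f assume f: "f \<in> C"
        show "c * u x \<le> f (c *\<^sub>R x)"
          unfolding hom[OF f that(2,1)] using le[OF f that(2)] that(1) by (simp add: mult_left_mono)
      qed
      have "sublinear_on S u"
        unfolding sublinear_on_def
      proof (intro conjI ballI allI impI)
        fix a b assume a: "a \<in> S" and b: "b \<in> S"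
        have "u (a + b) - g b \<le> u a" if g: "g \<in> C" for g
        proof (rule ge[OF a])
          fix f assume f: "f \<in> C"
          obtain h where h: "h \<in> C" "h \<le> f" "h \<le> g" using chain[OF f g] f g by blast
          have "u (a + b) \<le> h a + h b"
            using le[OF h(1), of "a + b"] sub[OF h(1) a b] a b S by (simp add: subspace_add)
          then show "u (a + b) - g b \<le> f a"
            using h(2,3) by (smt (verit) le_funD)
        qed
        then have "u (a + b) - u a \<le> u b"
          by (intro ge[OF b]) (simp add: algebra_simps)
        then show "u (a + b) \<le> u a + u b" by simp
      next
        fix c :: real and x assume c: "0 < c" and x: "x \<in> S"
        have "inverse c * u (c *\<^sub>R x) \<le> u x"
          using scale[of "inverse c" "c *\<^sub>R x"] c x S by (simp add: subspace_scale)
        then have "u (c *\<^sub>R x) \<le> c * u x" using c by (simp add: field_simps)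
        then show "u (c *\<^sub>R x) = c * u x" using scale[OF c x] by simp
      qed
      moreover have "u x \<le> p x" if "x \<in> S" for x
      proof -
        obtain f where f: "f \<in> C" using False by blast
        then have "f x \<le> p x" using CQ that by (auto simp: Q_def)
        then show ?thesis using le[OF f that] by simp
      qed
      ultimately have "u \<in> Q" by (simp add: Q_def u_def)
      moreover have "u \<le> f" if "f \<in> C" for f
        using le[OF that] CQ that by (auto simp: le_fun_def Q_def u_def)
      ultimately show ?thesis by blast
    qed
  qed
  then obtain q where q: "q \<in> Q" and min: "\<And>a. a \<in> Q \<Longrightarrow> a \<le> q \<Longrightarrow> a = q" by blast
  show ?thesis
  proof
    show "sublinear_on S q" "\<And>x. x \<in> S \<Longrightarrow> q x \<le> p x" using q by (auto simp: Q_def)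
    fix q' x assume q': "sublinear_on S q'" "\<And>z. z \<in> S \<Longrightarrow> q' z \<le> q z" and x: "x \<in> S"
    have "(\<lambda>x. if x \<in> S then q' x else 0) = q"
    proof (rule min)
      show "(\<lambda>x. if x \<in> S then q' x else 0) \<in> Q"
        using cut[OF q'(1)] q'(2) q by (auto simp: Q_def intro: order_trans)
      show "(\<lambda>x. if x \<in> S then q' x else 0) \<le> q"
        using q'(2) q by (auto simp: le_fun_def Q_def)
    qed
    then show "q' x = q x" using x by (auto dest: fun_cong)
  qed
qed

text \<open>
  A form of the Hahn--Banach theorem: a minimal sublinear functional \<open>f\<close> is linear. Lowering \<open>f\<close> in
  the direction of any \<open>y\<close> by \<open>sublinear_on_directional\<close> cannot change it, and this says
  \<open>f x \<le> f (x + y) - f y\<close>.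
\<close>
lemma sublinear_dominates_linear:
  assumes S: "subspace S" and p: "sublinear_on S p"
  obtains f where "\<And>x y. x \<in> S \<Longrightarrow> y \<in> S \<Longrightarrow> f (x + y) = f x + f y"
    "\<And>c x. x \<in> S \<Longrightarrow> f (c *\<^sub>R x) = c * f x" "\<And>x. x \<in> S \<Longrightarrow> f x \<le> p x"
proof -
  obtain f where f: "sublinear_on S f" "\<And>x. x \<in> S \<Longrightarrow> f x \<le> p x"
    and min: "\<And>q' x. sublinear_on S q' \<Longrightarrow> (\<And>z. z \<in> S \<Longrightarrow> q' z \<le> f z) \<Longrightarrow> x \<in> S \<Longrightarrow> q' x = f x"
    using exists_minimal_sublinear[OF S p] by blast
  have add: "f (x + y) = f x + f y" if x: "x \<in> S" and y: "y \<in> S" for x y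
  proof (rule antisym)
    show "f (x + y) \<le> f x + f y" using f(1) x y by (simp add: sublinear_on_def)
    let ?g = "\<lambda>x. if x \<in> S then INF t\<in>{0..}. f (x + t *\<^sub>R y) - t * f y else 0"
    have g: "sublinear_on S ?g" by (rule sublinear_on_directional(1)[OF S f(1) y])
    have le: "?g z \<le> f (z + t *\<^sub>R y) - t * f y" if "z \<in> S" "0 \<le> t" for z t
      by (rule sublinear_on_directional(2)[OF S f(1) y that])
    have "?g x = f x"
      by (rule min[OF g _ x]) (use le[where t = 0] in simp)
    then show "f x + f y \<le> f (x + y)" using le[OF x, of 1] by simp
  qed
  have pos: "f (c *\<^sub>R x) = c * f x" if "x \<in> S" "0 \<le> c" for c x
    using f(1) that sublinear_on_lower_bound(1)[OF S f(1) that(1)]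
    by (cases "c = 0") (auto simp: sublinear_on_def)
  have hom: "f (c *\<^sub>R x) = c * f x" if x: "x \<in> S" for c x
  proof (cases "0 \<le> c")
    case False
    have "f (c *\<^sub>R x) + f ((- c) *\<^sub>R x) = 0"
      using add[of "c *\<^sub>R x" "(- c) *\<^sub>R x"] S x sublinear_on_lower_bound(1)[OF S f(1) x]
      by (simp add: subspace_scale subspace_neg)
    then show ?thesis using pos[OF x, of "- c"] False by simp
  qed (rule pos[OF x])
  show ?thesis using that[OF add hom f(2)] by blast
qed

lemma norming_functional:
  assumes ns: "normed_space V" and v: "v \<in> vecs V"
  obtains f where "f \<in> dual V" "f v = nrm V v" "\<And>x. x \<in> vecs V \<Longrightarrow> \<bar>f x\<bar> \<le> nrm V x"
proof -
  note S = nspace_subspace[OF ns]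
  have nrm: "sublinear_on (vecs V) (nrm V)"
    by (simp add: sublinear_on_def nrm_triangle[OF ns] nrm_scale[OF ns])
  define p where "p = (\<lambda>x. if x \<in> vecs V then INF t\<in>{0..}. nrm V (x + t *\<^sub>R v) - t * nrm V v else 0)"
  have p: "sublinear_on (vecs V) p"
    unfolding p_def by (rule sublinear_on_directional(1)[OF S nrm v])
  have p_le: "p x \<le> nrm V (x + t *\<^sub>R v) - t * nrm V v" if "x \<in> vecs V" "0 \<le> t" for x t
    unfolding p_def by (rule sublinear_on_directional(2)[OF S nrm v that])
  obtain f where add: "\<And>x y. x \<in> vecs V \<Longrightarrow> y \<in> vecs V \<Longrightarrow> f (x + y) = f x + f y"
    and hom: "\<And>c x. x \<in> vecs V \<Longrightarrow> f (c *\<^sub>R x) = c * f x" and f: "\<And>x. x \<in> vecs V \<Longrightarrow> f x \<le> p x"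
    using sublinear_dominates_linear[OF S p] by blast
  have neg: "f (- x) = - f x" if "x \<in> vecs V" for x
    using hom[OF that, of "-1"] by simp
  have neg_mem: "- x \<in> vecs V" if "x \<in> vecs V" for x
    using subspace_neg[OF S that] .
  have le: "f x \<le> nrm V x" if "x \<in> vecs V" for x
    using f[OF that] p_le[OF that, of 0] by simp
  have abs: "\<bar>f x\<bar> \<le> nrm V x" if "x \<in> vecs V" for x
    using le[OF that] le[OF neg_mem[OF that]] neg[OF that] nrm_scale[OF ns that, of "-1"] by simp
  have "f (- v) \<le> - nrm V v"
    using f[OF neg_mem[OF v]] p_le[OF neg_mem[OF v], of 1] nrm_zero[OF ns] by simp
  then have "f v = nrm V v" using neg[OF v] le[OF v] by simp
  moreover have "f \<in> dual V"
    using add hom abs unfolding dual_def by (auto intro!: exI[of _ 1])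
  ultimately show ?thesis using that abs by blast
qed

section \<open>Weak convergence and the Schur property\<close>

lemma dual_zero: "(\<lambda>_. 0) \<in> dual V"
  by (auto simp: dual_def intro!: exI[of _ 0])

lemma dual_add: "f \<in> dual V \<Longrightarrow> x \<in> vecs V \<Longrightarrow> y \<in> vecs V \<Longrightarrow> f (x + y) = f x + f y"
  by (simp add: dual_def)

lemma dual_scale: "f \<in> dual V \<Longrightarrow> x \<in> vecs V \<Longrightarrow> f (c *\<^sub>R x) = c * f x"
  by (simp add: dual_def)

lemma dual_diff:
  assumes "normed_space V" "f \<in> dual V" "x \<in> vecs V" "y \<in> vecs V"
  shows "f (x - y) = f x - f y"
  using dual_add[OF assms(2) nspace_diff[OF assms(1,3,4)] assms(4)] by simp

lemma dual_bound:
  assumes "normed_space V" "f \<in> dual V"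
  obtains C where "0 \<le> C" "\<And>x. x \<in> vecs V \<Longrightarrow> \<bar>f x\<bar> \<le> C * nrm V x"
proof -
  obtain C where C: "\<And>x. x \<in> vecs V \<Longrightarrow> \<bar>f x\<bar> \<le> C * nrm V x"
    using assms(2) unfolding dual_def by blast
  have "\<bar>f x\<bar> \<le> \<bar>C\<bar> * nrm V x" if "x \<in> vecs V" for x
    using C[OF that] mult_right_mono[OF abs_ge_self nrm_nonneg[OF assms(1) that]]
    by (meson order_trans)
  then show ?thesis using that[of "\<bar>C\<bar>"] by simp
qed

text \<open>
  Convergence need only be tested on the generating sets of a topology, since the sets that
  eventually contain the sequence whenever they contain \<open>l\<close> are closed under finite intersections
  and arbitrary unions.
\<close>
lemma limitin_weak_topology_iff:
  assumes x: "\<And>n. x n \<in> vecs V" and l: "l \<in> vecs V"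
  shows "limitin (weak_topology V) x l sequentially \<longleftrightarrow> (\<forall>f\<in>dual V. (\<lambda>n. f (x n)) \<longlonglongrightarrow> f l)"
proof
  assume lim: "limitin (weak_topology V) x l sequentially"
  show "\<forall>f\<in>dual V. (\<lambda>n. f (x n)) \<longlonglongrightarrow> f l"
  proof (intro ballI topological_tendstoI)
    fix f U assume f: "f \<in> dual V" and U: "open U" "f l \<in> U"
    have "openin (weak_topology V) {x \<in> vecs V. f x \<in> U}"
      unfolding weak_topology_def using f U by (intro topology_generated_by_Basis) blast
    then have "eventually (\<lambda>n. x n \<in> {x \<in> vecs V. f x \<in> U}) sequentially"
      using lim l U by (auto simp: limitin_def)
    then show "eventually (\<lambda>n. f (x n) \<in> U) sequentially"
      by (rule eventually_mono) simp
  qed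
next
  assume conv: "\<forall>f\<in>dual V. (\<lambda>n. f (x n)) \<longlonglongrightarrow> f l"
  have "vecs V \<in> {{x \<in> vecs V. f x \<in> U} | f U. f \<in> dual V \<and> open U}"
    using dual_zero[of V] by (auto intro!: exI[of _ "\<lambda>_. 0"] exI[of _ UNIV])
  then have "l \<in> topspace (weak_topology V)"
    unfolding weak_topology_def topology_generated_by_topspace using l by blast
  moreover have "eventually (\<lambda>n. x n \<in> W) sequentially"
    if "openin (weak_topology V) W" "l \<in> W" for W
    using openin_topology_generated_by[OF that(1)[unfolded weak_topology_def]] that(2)
  proof induction
    case (Int a b)
    then show ?case by (simp add: eventually_conj_iff)
  next
    case (UN K)
    then obtain k where k: "k \<in> K" "l \<in> k" by blast
    show ?case by (rule eventually_mono[OF UN(2)[OF k]]) (use k(1) in blast)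
  next
    case (Basis W)
    then obtain f U where f: "f \<in> dual V" and U: "open U" and W: "W = {x \<in> vecs V. f x \<in> U}"
      by blast
    have "eventually (\<lambda>n. f (x n) \<in> U) sequentially"
      using topological_tendstoD[OF conv[rule_format, OF f] U] Basis(2) W by simp
    then show ?case by (rule eventually_mono) (simp add: W x)
  qed simp
  ultimately show "limitin (weak_topology V) x l sequentially"
    by (simp add: limitin_def)
qed

text \<open>
  Weak lower semicontinuity of the norm: a norming functional of \<open>l\<close> bounds \<open>\<parallel>x n\<parallel>\<close> from below.
\<close>
lemma weakly_convergent_norm_lsc:
  assumes ns: "normed_space V" and l: "l \<in> vecs V" and x: "\<And>n. x n \<in> vecs V"
    and conv: "\<And>f. f \<in> dual V \<Longrightarrow> (\<lambda>n. f (x n)) \<longlonglongrightarrow> f l" and c: "c < nrm V l"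
  shows "eventually (\<lambda>n. c < nrm V (x n)) sequentially"
proof -
  obtain f where f: "f \<in> dual V" "f l = nrm V l" "\<And>x. x \<in> vecs V \<Longrightarrow> \<bar>f x\<bar> \<le> nrm V x"
    using norming_functional[OF ns l] by blast
  have "eventually (\<lambda>n. c < f (x n)) sequentially"
    using order_tendstoD(1)[OF conv[OF f(1)]] c f(2) by simp
  then show ?thesis
    by (rule eventually_mono) (use f(3)[OF x] in \<open>smt (verit)\<close>)
qed

lemma norm_convergent_imp_weakly_convergent:
  assumes ns: "normed_space V" and l: "l \<in> vecs V" and x: "\<And>n. x n \<in> vecs V"
    and conv: "(\<lambda>n. nrm V (x n - l)) \<longlonglongrightarrow> 0" and f: "f \<in> dual V"
  shows "(\<lambda>n. f (x n)) \<longlonglongrightarrow> f l"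
proof -
  obtain C where C: "\<And>x. x \<in> vecs V \<Longrightarrow> \<bar>f x\<bar> \<le> C * nrm V x"
    using dual_bound[OF ns f] by blast
  have "(\<lambda>n. f (x n) - f l) \<longlonglongrightarrow> 0"
  proof (rule Lim_null_comparison)
    show "eventually (\<lambda>n. norm (f (x n) - f l) \<le> C * nrm V (x n - l)) sequentially"
      using C[OF nspace_diff[OF ns x l]] dual_diff[OF ns f x l] by simp
    show "(\<lambda>n. C * nrm V (x n - l)) \<longlonglongrightarrow> 0"
      using tendsto_mult_left[OF conv, of C] by simp
  qed
  then show ?thesis by (simp add: LIM_zero_iff)
qed

text \<open>
  The Schur property only provides some limit in norm. It is the weak limit, because a norming
  functional of the difference would separate the two.
\<close>
lemma schur_property_imp_norm_convergent:
  assumes ns: "normed_space V" and schur: "schur_property V"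
    and l: "l \<in> vecs V" and x: "\<And>n. x n \<in> vecs V"
    and conv: "\<And>f. f \<in> dual V \<Longrightarrow> (\<lambda>n. f (x n)) \<longlonglongrightarrow> f l"
  shows "(\<lambda>n. nrm V (x n - l)) \<longlonglongrightarrow> 0"
proof -
  have "limitin (weak_topology V) x l sequentially"
    using conv by (simp add: limitin_weak_topology_iff[OF x l])
  then obtain k where k: "limitin (norm_topology V) x k sequentially"
    using schur x unfolding schur_property_def by blast
  have kV: "k \<in> vecs V"
    using limitin_topspace[OF k] Metric_space.topspace_mtopology[OF metric_space_ndist[OF ns]]
    by (simp add: norm_topology_def)
  have to_k: "(\<lambda>n. nrm V (x n - k)) \<longlonglongrightarrow> 0"
    using k limitin_norm_topology_iff[OF ns x kV] by simp
  obtain f where f: "f \<in> dual V" "f (k - l) = nrm V (k - l)"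
    using norming_functional[OF ns nspace_diff[OF ns kV l]] by blast
  have "f k = f l"
    using LIMSEQ_unique[OF norm_convergent_imp_weakly_convergent[OF ns kV x to_k f(1)] conv[OF f(1)]] .
  then have "nrm V (k - l) = 0" using f dual_diff[OF ns f(1) kV l] by simp
  then have "k = l" using nrm_eq_0_iff[OF ns nspace_diff[OF ns kV l]] by simp
  then show ?thesis using to_k by simp
qed

text \<open>
  A weakly convergent sequence that stays away from its limit along a subsequence is normalised.
  Dividing by norms that are at least \<open>d\<close> keeps a sequence weakly null.
\<close>
lemma not_schur_weakly_null_unit_sequence:
  assumes ns: "normed_space V" and "\<not> schur_property V"
  obtains w where "\<And>n. w n \<in> vecs V" "\<And>n. nrm V (w n) = 1"
    "\<And>f. f \<in> dual V \<Longrightarrow> (\<lambda>n. f (w n)) \<longlonglongrightarrow> 0"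
proof -
  obtain x l where x: "\<And>n. x n \<in> vecs V" and weak: "limitin (weak_topology V) x l sequentially"
    and no_lim: "\<And>k. \<not> limitin (norm_topology V) x k sequentially"
    using assms(2) unfolding schur_property_def by blast
  have l: "l \<in> vecs V"
    using limitin_topspace[OF weak]
    unfolding weak_topology_def topology_generated_by_topspace by blast
  have xl: "x n - l \<in> vecs V" for n by (rule nspace_diff[OF ns x l])
  have "\<not> (\<lambda>n. nrm V (x n - l)) \<longlonglongrightarrow> 0"
    using no_lim[of l] limitin_norm_topology_iff[OF ns x l] by simp
  then obtain d where d: "0 < d" and "\<not> eventually (\<lambda>n. dist (nrm V (x n - l)) 0 < d) sequentially"
    unfolding tendsto_iff by blast
  then have "\<exists>\<^sub>\<infinity>n. \<not> dist (nrm V (x n - l)) 0 < d"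
    by (simp add: not_eventually cofinite_eq_sequentially)
  then have "\<exists>\<^sub>\<infinity>n. d \<le> nrm V (x n - l)"
    by (rule frequently_elim1) (simp add: nrm_nonneg[OF ns xl])
  then obtain r :: "nat \<Rightarrow> nat" where r: "strict_mono r" "\<And>n. d \<le> nrm V (x (r n) - l)"
    using infinite_enumerate[of "{n. d \<le> nrm V (x n - l)}"] by (auto simp: INFM_iff_infinite)
  have pos: "0 < nrm V (x (r n) - l)" for n using r(2)[of n] d by linarith
  define w where "w = (\<lambda>n. inverse (nrm V (x (r n) - l)) *\<^sub>R (x (r n) - l))"
  show ?thesis
  proof
    show "w n \<in> vecs V" for n unfolding w_def by (rule nspace_scale[OF ns xl])
    show "nrm V (w n) = 1" for n using pos[of n] by (simp add: w_def nrm_scale[OF ns xl])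
    fix f assume f: "f \<in> dual V"
    have "(\<lambda>n. f (x n)) \<longlonglongrightarrow> f l" using weak f limitin_weak_topology_iff[where x = x, OF x l] by blast
    then have "(\<lambda>n. f (x (r n))) \<longlonglongrightarrow> f l"
      using LIMSEQ_subseq_LIMSEQ[OF _ r(1), of "\<lambda>n. f (x n)" "f l"] by (simp add: o_def)
    then have "(\<lambda>n. inverse d * \<bar>f (x (r n)) - f l\<bar>) \<longlonglongrightarrow> inverse d * \<bar>f l - f l\<bar>"
      by (intro tendsto_intros)
    then have lim: "(\<lambda>n. inverse d * \<bar>f (x (r n)) - f l\<bar>) \<longlonglongrightarrow> 0" by simp
    show "(\<lambda>n. f (w n)) \<longlonglongrightarrow> 0"
    proof (rule Lim_null_comparison[OF always_eventually lim], rule allI)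
      fix n
      have "inverse (nrm V (x (r n) - l)) \<le> inverse d" using r(2)[of n] d by simp
      then show "norm (f (w n)) \<le> inverse d * \<bar>f (x (r n)) - f l\<bar>"
        unfolding w_def dual_scale[OF f xl] dual_diff[OF ns f x l] real_norm_def abs_mult
        using pos[of n] by (intro mult_right_mono) simp_all
    qed
  qed
qed

section \<open>Kadets--Klee properties without normalisation\<close>

text \<open>
  The definition speaks of the unit sphere only; dividing by the norms removes this restriction.
  The set \<open>\<Phi>\<close> of homogeneous functions stands for the functionals or coordinates that determine
  the topology, which makes the argument serve the weak and the point-wise topology alike.
\<close>
lemma kadets_klee_nonnormalised:
  assumes ns: "normed_space V" and kk: "kadets_klee V T"
    and top: "\<And>y k. (\<And>n. y n \<in> vecs V) \<Longrightarrow> k \<in> vecs V \<Longrightarrow> (\<And>f. f \<in> \<Phi> \<Longrightarrow> (\<lambda>n. f (y n)) \<longlonglongrightarrow> f k)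
      \<Longrightarrow> limitin T y k sequentially"
    and hom: "\<And>f c v. f \<in> \<Phi> \<Longrightarrow> v \<in> vecs V \<Longrightarrow> f (c *\<^sub>R v) = c * f v"
    and x: "\<And>n. x n \<in> vecs V" and l: "l \<in> vecs V"
    and norms: "(\<lambda>n. nrm V (x n)) \<longlonglongrightarrow> nrm V l"
    and conv: "\<And>f. f \<in> \<Phi> \<Longrightarrow> (\<lambda>n. f (x n)) \<longlonglongrightarrow> f l"
  shows "(\<lambda>n. nrm V (x n - l)) \<longlonglongrightarrow> 0"
proof (cases "l = 0")
  case True
  then show ?thesis using norms nrm_zero[OF ns] by simp
next
  case False
  have pos: "0 < nrm V l"
    using False nrm_nonneg[OF ns l] nrm_eq_0_iff[OF ns l] by simp
  define k where "k = inverse (nrm V l) *\<^sub>R l"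
  \<comment> \<open>Finitely many \<open>x n\<close> may vanish; any unit vector will do for these.\<close>
  define y where "y = (\<lambda>n. if nrm V (x n) = 0 then k else inverse (nrm V (x n)) *\<^sub>R x n)"
  have k: "k \<in> vecs V" "nrm V k = 1"
    using pos by (simp_all add: k_def nspace_scale[OF ns l] nrm_scale[OF ns l])
  have y: "y n \<in> vecs V" "nrm V (y n) = 1" for n
    using k nrm_nonneg[OF ns x[of n]]
    by (auto simp: y_def nspace_scale[OF ns x] nrm_scale[OF ns x])
  have ev: "eventually (\<lambda>n. nrm V (x n) \<noteq> 0) sequentially"
    using order_tendstoD(1)[OF norms pos] by (rule eventually_mono) simp
  have "limitin T y k sequentially"
  proof (rule top[OF y(1) k(1)])
    fix f assume f: "f \<in> \<Phi>"
    have "(\<lambda>n. inverse (nrm V (x n)) * f (x n)) \<longlonglongrightarrow> inverse (nrm V l) * f l"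
      using pos by (intro tendsto_intros norms conv[OF f]) simp
    then show "(\<lambda>n. f (y n)) \<longlonglongrightarrow> f k"
      unfolding k_def hom[OF f l]
      by (rule Lim_transform_eventually)
        (use ev in eventually_elim, simp add: y_def hom[OF f x])
  qed
  then have "(\<lambda>n. nrm V (y n - k)) \<longlonglongrightarrow> 0"
    using kk y k unfolding kadets_klee_def by blast
  then have "(\<lambda>n. nrm V (x n) * nrm V (y n - k) + \<bar>nrm V (x n) - nrm V l\<bar>)
      \<longlonglongrightarrow> nrm V l * 0 + \<bar>nrm V l - nrm V l\<bar>"
    by (intro tendsto_intros norms)
  then have bound: "(\<lambda>n. nrm V (x n) * nrm V (y n - k) + \<bar>nrm V (x n) - nrm V l\<bar>) \<longlonglongrightarrow> 0"
    by simp
  show ?thesis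
  proof (rule Lim_null_comparison[OF _ bound], use ev in eventually_elim)
    fix n assume n: "nrm V (x n) \<noteq> 0"
    have "x n - l = nrm V (x n) *\<^sub>R (y n - k) + (nrm V (x n) - nrm V l) *\<^sub>R k"
      using n pos by (simp add: y_def k_def algebra_simps)
    then have "nrm V (x n - l)
        \<le> nrm V (nrm V (x n) *\<^sub>R (y n - k)) + nrm V ((nrm V (x n) - nrm V l) *\<^sub>R k)"
      using nrm_triangle[OF ns] y(1) k(1) by (simp add: nspace_closed[OF ns])
    then show "norm (nrm V (x n - l)) \<le> nrm V (x n) * nrm V (y n - k) + \<bar>nrm V (x n) - nrm V l\<bar>"
      using y(1) k nrm_nonneg[OF ns x[of n]] nrm_nonneg[OF ns nspace_diff[OF ns x[of n] l]]
      by (simp add: nrm_scale[OF ns] nspace_closed[OF ns])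
  qed
qed

lemma kadets_klee_weak_nonnormalised:
  assumes ns: "normed_space V" and kk: "kadets_klee V (weak_topology V)"
    and x: "\<And>n. x n \<in> vecs V" and l: "l \<in> vecs V"
    and norms: "(\<lambda>n. nrm V (x n)) \<longlonglongrightarrow> nrm V l"
    and conv: "\<And>f. f \<in> dual V \<Longrightarrow> (\<lambda>n. f (x n)) \<longlonglongrightarrow> f l"
  shows "(\<lambda>n. nrm V (x n - l)) \<longlonglongrightarrow> 0"
proof (rule kadets_klee_nonnormalised[OF ns kk _ _ x l norms conv])
  show "limitin (weak_topology V) y k sequentially"
    if "\<And>n. y n \<in> vecs V" "k \<in> vecs V" "\<And>f. f \<in> dual V \<Longrightarrow> (\<lambda>n. f (y n)) \<longlonglongrightarrow> f k" for y k
    unfolding limitin_weak_topology_iff[where x = y, OF that(1,2)] using that(3) by blast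
qed (rule dual_scale)

section \<open>Order continuity of Banach sequence spaces\<close>

lemma bss_normed_space: "banach_sequence_space \<Gamma> E \<Longrightarrow> normed_space E"
  by (simp add: banach_sequence_space_def banach_space_def)

lemma bss_outside: "banach_sequence_space \<Gamma> E \<Longrightarrow> x \<in> vecs E \<Longrightarrow> \<gamma> \<notin> \<Gamma> \<Longrightarrow> x \<gamma> = 0"
  by (auto simp: banach_sequence_space_def omega_def)

lemma bss_ideal:
  assumes E: "banach_sequence_space \<Gamma> E" and y: "y \<in> vecs E" and le: "\<And>\<gamma>. \<bar>x \<gamma>\<bar> \<le> \<bar>y \<gamma>\<bar>"
  shows "x \<in> vecs E" "nrm E x \<le> nrm E y"
proof -
  have "x \<in> omega \<Gamma>"
    unfolding omega_def
  proof (intro CollectI allI impI)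
    fix \<gamma> assume "\<gamma> \<notin> \<Gamma>"
    then show "x \<gamma> = 0" using le[of \<gamma>] bss_outside[OF E y, of \<gamma>] by simp
  qed
  then show "x \<in> vecs E" "nrm E x \<le> nrm E y"
    using E y le by (simp_all add: banach_sequence_space_def)
qed

lemma bss_indicator: "banach_sequence_space \<Gamma> E \<Longrightarrow> finite F \<Longrightarrow> F \<subseteq> \<Gamma> \<Longrightarrow> indicator F \<in> vecs E"
  by (simp add: banach_sequence_space_def)

lemma bss_unit_pos:
  assumes E: "banach_sequence_space \<Gamma> E" and \<gamma>: "\<gamma> \<in> \<Gamma>"
  shows "0 < nrm E (indicator {\<gamma>})"
proof -
  have e: "indicator {\<gamma>} \<in> vecs E" using bss_indicator[OF E, of "{\<gamma>}"] \<gamma> by simp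
  have "indicator {\<gamma>} \<noteq> (0 :: 'a \<Rightarrow> real)"
  proof
    assume "indicator {\<gamma>} = (0 :: 'a \<Rightarrow> real)"
    then have "indicator {\<gamma>} \<gamma> = (0 :: 'a \<Rightarrow> real) \<gamma>" by (rule fun_cong)
    then show False by simp
  qed
  then show ?thesis
    using nrm_nonneg[OF bss_normed_space[OF E] e] nrm_eq_0_iff[OF bss_normed_space[OF E] e] by simp
qed

lemma bss_coordinate_le:
  assumes E: "banach_sequence_space \<Gamma> E" and \<gamma>: "\<gamma> \<in> \<Gamma>" and x: "x \<in> vecs E"
  shows "\<bar>x \<gamma>\<bar> * nrm E (indicator {\<gamma>}) \<le> nrm E x"
proof -
  have e: "indicator {\<gamma>} \<in> vecs E" using bss_indicator[OF E, of "{\<gamma>}"] \<gamma> by simp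
  have "nrm E (x \<gamma> *\<^sub>R indicator {\<gamma>}) \<le> nrm E x"
    by (rule bss_ideal(2)[OF E x]) (simp add: indicator_def)
  then show ?thesis by (simp add: nrm_scale[OF bss_normed_space[OF E] e])
qed

lemma bss_norm_convergent_imp_pointwise:
  assumes E: "banach_sequence_space \<Gamma> E" and x: "\<And>n. x n \<in> vecs E" and l: "l \<in> vecs E"
    and conv: "(\<lambda>n. nrm E (x n - l)) \<longlonglongrightarrow> 0"
  shows "(\<lambda>n. x n \<gamma>) \<longlonglongrightarrow> l \<gamma>"
proof (cases "\<gamma> \<in> \<Gamma>")
  case True
  note pos = bss_unit_pos[OF E True]
  have "(\<lambda>n. x n \<gamma> - l \<gamma>) \<longlonglongrightarrow> 0"
  proof (rule Lim_null_comparison)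
    show "eventually (\<lambda>n. norm (x n \<gamma> - l \<gamma>) \<le> nrm E (x n - l) / nrm E (indicator {\<gamma>})) sequentially"
      using bss_coordinate_le[OF E True nspace_diff[OF bss_normed_space[OF E] x l]] pos
      by (simp add: field_simps)
    show "(\<lambda>n. nrm E (x n - l) / nrm E (indicator {\<gamma>})) \<longlonglongrightarrow> 0"
      using tendsto_divide[OF conv tendsto_const, of "nrm E (indicator {\<gamma>})"] pos by simp
  qed
  then show ?thesis by (simp add: LIM_zero_iff)
next
  case False
  then show ?thesis using bss_outside[OF E x] bss_outside[OF E l] by simp
qed

lemma limitin_pointwise_topology:
  assumes "\<And>n. y n \<in> vecs E" "k \<in> vecs E" "\<And>\<gamma>. (\<lambda>n. y n \<gamma>) \<longlonglongrightarrow> k \<gamma>"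
  shows "limitin (pointwise_topology E) y k sequentially"
  using assms unfolding pointwise_topology_def limitin_subtopology
  by (simp add: limitin_componentwise flip: euclidean_product_topology)

lemma kadets_klee_pointwise_nonnormalised:
  assumes E: "banach_sequence_space \<Gamma> E" and kk: "kadets_klee E (pointwise_topology E)"
    and x: "\<And>n. x n \<in> vecs E" and l: "l \<in> vecs E"
    and norms: "(\<lambda>n. nrm E (x n)) \<longlonglongrightarrow> nrm E l" and conv: "\<And>\<gamma>. (\<lambda>n. x n \<gamma>) \<longlonglongrightarrow> l \<gamma>"
  shows "(\<lambda>n. nrm E (x n - l)) \<longlonglongrightarrow> 0"
proof (rule kadets_klee_nonnormalised[OF bss_normed_space[OF E] kk _ _ x l norms])
  let ?\<Phi> = "range (\<lambda>\<gamma> z :: 'a \<Rightarrow> real. z \<gamma>)"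
  show "limitin (pointwise_topology E) y k sequentially"
    if y: "\<And>n. y n \<in> vecs E" "k \<in> vecs E" and "\<And>f. f \<in> ?\<Phi> \<Longrightarrow> (\<lambda>n. f (y n)) \<longlonglongrightarrow> f k" for y k
  proof (rule limitin_pointwise_topology[OF y])
    show "(\<lambda>n. y n \<gamma>) \<longlonglongrightarrow> k \<gamma>" for \<gamma> using that(3)[of "\<lambda>z. z \<gamma>"] by simp
  qed
  show "(\<lambda>n. f (x n)) \<longlonglongrightarrow> f l" if "f \<in> ?\<Phi>" for f using that conv by auto
  show "f (c *\<^sub>R v) = c * f v" if "f \<in> ?\<Phi>" for f c v using that by auto
qed

definition coord_restrict :: "'g set \<Rightarrow> ('g \<Rightarrow> real) \<Rightarrow> 'g \<Rightarrow> real" where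
  "coord_restrict A x = (\<lambda>\<gamma>. if \<gamma> \<in> A then x \<gamma> else 0)"

lemma coord_restrict_apply [simp]: "coord_restrict A x \<gamma> = (if \<gamma> \<in> A then x \<gamma> else 0)"
  by (simp add: coord_restrict_def)

lemma bss_coord_restrict:
  assumes E: "banach_sequence_space \<Gamma> E" and x: "x \<in> vecs E"
  shows "coord_restrict A x \<in> vecs E" and "A \<subseteq> B \<Longrightarrow> nrm E (coord_restrict A x) \<le> nrm E (coord_restrict B x)"
proof -
  show B: "coord_restrict A x \<in> vecs E" for A by (rule bss_ideal(1)[OF E x]) simp
  show "A \<subseteq> B \<Longrightarrow> nrm E (coord_restrict A x) \<le> nrm E (coord_restrict B x)"
    by (rule bss_ideal(2)[OF E B]) auto
qed

text \<open>
  If finite pieces of \<open>x\<close> beyond a large finite set are small, then the restrictions of \<open>x\<close> to an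
  exhausting sequence of finite sets are Cauchy. Their limit in norm is also their point-wise limit,
  which is \<open>x\<close>.
\<close>
lemma bss_cauchy_imp_small_tails:
  assumes \<Gamma>: "countable \<Gamma>" and E: "banach_sequence_space \<Gamma> E" and x: "x \<in> vecs E"
    and cauchy: "\<And>\<delta>. 0 < \<delta> \<Longrightarrow>
      \<exists>F. finite F \<and> F \<subseteq> \<Gamma> \<and> (\<forall>G. finite G \<longrightarrow> G \<subseteq> \<Gamma> - F \<longrightarrow> nrm E (coord_restrict G x) < \<delta>)"
    and \<epsilon>: "0 < \<epsilon>"
  shows "\<exists>F. finite F \<and> F \<subseteq> \<Gamma> \<and> nrm E (coord_restrict (\<Gamma> - F) x) < \<epsilon>"
proof -
  note ns = bss_normed_space[OF E]
  interpret Metric_space "vecs E" "ndist E" by (rule metric_space_ndist[OF ns])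
  define D where "D = (\<lambda>n. {\<gamma> \<in> \<Gamma>. to_nat_on \<Gamma> \<gamma> < n})"
  have D: "finite (D n)" "D n \<subseteq> \<Gamma>" for n
    unfolding D_def
    using finite_vimage_IntI[of "{..<n}" "to_nat_on \<Gamma>" \<Gamma>] inj_on_to_nat_on[OF \<Gamma>]
    by (auto simp: vimage_def Int_def conj_commute)
  have D_mono: "D m \<subseteq> D n" if "m \<le> n" for m n using that by (auto simp: D_def)
  have covered: "\<exists>N. F \<subseteq> D N" if "finite F" "F \<subseteq> \<Gamma>" for F
  proof -
    have "F \<subseteq> D (Suc (Max (to_nat_on \<Gamma> ` F)))"
      using that by (auto simp: D_def less_Suc_eq_le)
    then show ?thesis ..
  qed
  define \<sigma> where "\<sigma> = (\<lambda>n. coord_restrict (D n) x)"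
  have \<sigma>: "\<sigma> n \<in> vecs E" for n unfolding \<sigma>_def by (rule bss_coord_restrict(1)[OF E x])
  have "MCauchy \<sigma>"
    unfolding MCauchy_def
  proof (intro conjI allI impI)
    show "range \<sigma> \<subseteq> vecs E" using \<sigma> by auto
    fix \<delta> :: real assume "0 < \<delta>"
    then obtain F where F: "finite F" "F \<subseteq> \<Gamma>"
      and small: "\<And>G. finite G \<Longrightarrow> G \<subseteq> \<Gamma> - F \<Longrightarrow> nrm E (coord_restrict G x) < \<delta>"
      using cauchy[OF \<open>0 < \<delta>\<close>] by auto
    obtain N where N: "F \<subseteq> D N" using covered[OF F] by blast
    have step: "ndist E (\<sigma> n) (\<sigma> m) < \<delta>" if "N \<le> m" "m \<le> n" for m n
    proof -
      have "\<sigma> n - \<sigma> m = coord_restrict (D n - D m) x"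
      proof (rule ext)
        fix \<gamma> show "(\<sigma> n - \<sigma> m) \<gamma> = coord_restrict (D n - D m) x \<gamma>"
          using subsetD[OF D_mono[OF that(2)], of \<gamma>] by (simp add: \<sigma>_def)
      qed
      moreover have "nrm E (coord_restrict (D n - D m) x) < \<delta>"
      proof (rule small)
        show "finite (D n - D m)" using D(1) by simp
        show "D n - D m \<subseteq> \<Gamma> - F" using D(2)[of n] N D_mono[OF that(1)] by blast
      qed
      ultimately show ?thesis using \<sigma> by (simp add: ndist_def)
    qed
    show "\<exists>N. \<forall>n n'. N \<le> n \<longrightarrow> N \<le> n' \<longrightarrow> ndist E (\<sigma> n) (\<sigma> n') < \<delta>"
    proof (intro exI[of _ N] allI impI)
      fix m n assume "N \<le> m" "N \<le> n"
      then have "ndist E (\<sigma> n) (\<sigma> m) < \<delta> \<or> ndist E (\<sigma> m) (\<sigma> n) < \<delta>"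
        using step[of m n] step[of n m] by (cases "m \<le> n") simp_all
      then show "ndist E (\<sigma> m) (\<sigma> n) < \<delta>"
        by (simp only: commute[of "\<sigma> m" "\<sigma> n"] disj_absorb)
    qed
  qed
  moreover have mcomplete
    using E by (simp add: banach_sequence_space_def banach_space_def)
  ultimately obtain l where "limitin mtopology \<sigma> l sequentially"
    unfolding mcomplete_def by auto
  then have lim: "limitin (norm_topology E) \<sigma> l sequentially"
    by (simp only: norm_topology_def)
  have l: "l \<in> vecs E" using limitin_topspace[OF lim] by (simp add: norm_topology_def)
  have conv: "(\<lambda>n. nrm E (\<sigma> n - l)) \<longlonglongrightarrow> 0"
    using lim limitin_norm_topology_iff[OF ns \<sigma> l] by simp
  have "l \<gamma> = x \<gamma>" for \<gamma>
  proof -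
    have "eventually (\<lambda>n. \<sigma> n \<gamma> = x \<gamma>) sequentially"
    proof (cases "\<gamma> \<in> \<Gamma>")
      case True
      then obtain N where "\<gamma> \<in> D N" using covered[of "{\<gamma>}"] by auto
      then have "\<forall>n\<ge>N. \<gamma> \<in> D n" using D_mono by blast
      then show ?thesis by (auto simp: \<sigma>_def eventually_sequentially)
    qed (use bss_outside[OF E x] in \<open>simp add: \<sigma>_def\<close>)
    then have "(\<lambda>n. \<sigma> n \<gamma>) \<longlonglongrightarrow> x \<gamma>" by (rule tendsto_eventually)
    then show ?thesis
      using LIMSEQ_unique[OF bss_norm_convergent_imp_pointwise[OF E \<sigma> l conv]] by blast
  qed
  then have "l = x" by (simp add: fun_eq_iff)
  then obtain n where n: "nrm E (x - \<sigma> n) < \<epsilon>"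
    using order_tendstoD(2)[OF conv \<epsilon>] nrm_minus_commute[OF ns x \<sigma>]
    by (auto simp: eventually_sequentially)
  have "x - \<sigma> n = coord_restrict (\<Gamma> - D n) x"
    using bss_outside[OF E x] D by (auto simp: \<sigma>_def fun_eq_iff)
  then show ?thesis using D n by (intro exI[of _ "D n"]) simp
qed

text \<open>
  Otherwise blocks of norm at least \<open>\<delta>\<close> exist beyond every finite set. Call a set rich if it contains
  such blocks. Given a finite set \<open>F\<close> and a rich set \<open>A\<close>, one can pass to a rich \<open>A'\<close> inside \<open>A\<close> for which
  \<open>\<mu> (F \<union> A')\<close> is almost minimal among the rich subsets of \<open>A\<close>. Shrinking \<open>A'\<close> further then hardly lowers
  the norm. Iterating with tolerances \<open>1 / (n + 1)\<close>, and moving one block from \<open>A'\<close> to \<open>F\<close> each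
  time, produces \<open>F 0 \<subseteq> F 1 \<subseteq> \<dots>\<close> with union \<open>U\<close>. Both \<open>U\<close> and \<open>U\<close> without its \<open>n\<close>-th block
  consist of \<open>F n\<close> and a rich part of the set from which the \<open>n\<close>-th block was taken, hence have almost the same norm.
\<close>
lemma kadets_klee_pointwise_imp_cauchy:
  assumes E: "banach_sequence_space \<Gamma> E" and kk: "kadets_klee E (pointwise_topology E)"
    and x: "x \<in> vecs E" and \<delta>: "0 < \<delta>"
  shows "\<exists>F. finite F \<and> F \<subseteq> \<Gamma> \<and> (\<forall>G. finite G \<longrightarrow> G \<subseteq> \<Gamma> - F \<longrightarrow> nrm E (coord_restrict G x) < \<delta>)"
proof (rule ccontr)
  assume neg: "\<not> ?thesis"
  note ns = bss_normed_space[OF E]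
  define \<mu> where "\<mu> = (\<lambda>A. nrm E (coord_restrict A x))"
  have \<mu>_mono: "\<mu> A \<le> \<mu> B" if "A \<subseteq> B" for A B
    unfolding \<mu>_def by (rule bss_coord_restrict(2)[OF E x that])
  have \<mu>_nonneg: "0 \<le> \<mu> A" for A
    unfolding \<mu>_def by (rule nrm_nonneg[OF ns bss_coord_restrict(1)[OF E x]])
  define rich where
    "rich = (\<lambda>A. \<forall>F. finite F \<longrightarrow> (\<exists>G. finite G \<and> G \<subseteq> A - F \<and> \<delta> \<le> \<mu> G))"
  have "rich \<Gamma>"
    unfolding rich_def
  proof (intro allI impI)
    fix F :: "'a set" assume F: "finite F"
    show "\<exists>G. finite G \<and> G \<subseteq> \<Gamma> - F \<and> \<delta> \<le> \<mu> G"
    proof (rule ccontr)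
      assume none: "\<not> ?thesis"
      have "nrm E (coord_restrict G x) < \<delta>" if "finite G" "G \<subseteq> \<Gamma> - F \<inter> \<Gamma>" for G
      proof -
        have "G \<subseteq> \<Gamma> - F" using that(2) by blast
        then have "\<not> \<delta> \<le> \<mu> G" using none that(1) by simp
        then show ?thesis by (simp add: \<mu>_def)
      qed
      then have "\<exists>F. finite F \<and> F \<subseteq> \<Gamma> \<and> (\<forall>G. finite G \<longrightarrow> G \<subseteq> \<Gamma> - F \<longrightarrow> nrm E (coord_restrict G x) < \<delta>)"
        using F by (intro exI[of _ "F \<inter> \<Gamma>"]) simp
      then show False using neg by contradiction
    qed
  qed
  have refine: "\<exists>A'\<subseteq>A. rich A' \<and> (\<forall>B\<subseteq>A'. rich B \<longrightarrow> \<mu> (F \<union> A') - \<eta> \<le> \<mu> (F \<union> B))"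
    if A: "rich A" and \<eta>: "0 < \<eta>" for A F \<eta>
  proof -
    define M where "M = (\<lambda>B. \<mu> (F \<union> B)) ` {B. B \<subseteq> A \<and> rich B}"
    have "M \<noteq> {}" "Inf M < Inf M + \<eta>" using A \<eta> by (auto simp: M_def)
    then obtain t where t: "t \<in> M" "t < Inf M + \<eta>" using cInf_lessD by blast
    then obtain A' where A': "A' \<subseteq> A" "rich A'" "\<mu> (F \<union> A') < Inf M + \<eta>"
      by (auto simp: M_def)
    have bdd: "bdd_below M"
      unfolding M_def by (rule bdd_belowI2[where m = 0]) (rule \<mu>_nonneg)
    have "\<mu> (F \<union> A') - \<eta> \<le> \<mu> (F \<union> B)" if B: "B \<subseteq> A'" "rich B" for B
    proof -
      have "\<mu> (F \<union> B) \<in> M" unfolding M_def using B A'(1) by blast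
      then have "Inf M \<le> \<mu> (F \<union> B)" using bdd by (rule cInf_lower)
      then show ?thesis using A'(3) by simp
    qed
    then show ?thesis using A'(1,2) by (intro exI[of _ A']) simp
  qed
  \<comment> \<open>A state \<open>(F, A)\<close> consists of the blocks chosen so far and the rich set left for later ones.\<close>
  define Q where "Q = (\<lambda>(n::nat) (F, A) (F', A'). A' \<subseteq> A \<and> F \<subseteq> F' \<and> F' - F \<subseteq> A' \<and> \<delta> \<le> \<mu> (F' - F) \<and>
      (\<forall>B\<subseteq>A'. rich B \<longrightarrow> \<mu> (F \<union> A') - 1 / real (Suc n) \<le> \<mu> (F \<union> B)))"
  have "\<exists>s. \<forall>n. (finite (fst (s n)) \<and> rich (snd (s n))) \<and> Q n (s n) (s (Suc n))"
  proof (rule dependent_nat_choice)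
    show "\<exists>s. finite (fst s) \<and> rich (snd s)"
      using \<open>rich \<Gamma>\<close> by (intro exI[of _ "({}, \<Gamma>)"]) simp
    fix s :: "'a set \<times> 'a set" and n
    obtain F A where s: "s = (F, A)" by (cases s)
    assume "finite (fst s) \<and> rich (snd s)"
    then have F: "finite F" and A: "rich A" using s by auto
    have "0 < 1 / real (Suc n)" by simp
    from refine[OF A this, of F] obtain A' where A': "A' \<subseteq> A" "rich A'"
      "\<forall>B\<subseteq>A'. rich B \<longrightarrow> \<mu> (F \<union> A') - 1 / real (Suc n) \<le> \<mu> (F \<union> B)"
      by auto
    obtain G where G: "finite G" "G \<subseteq> A' - F" "\<delta> \<le> \<mu> G"
      using A'(2)[unfolded rich_def, rule_format, OF F] by auto
    have "F \<union> G - F = G" using G(2) by blast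
    then show "\<exists>s'. (finite (fst s') \<and> rich (snd s')) \<and> Q n s s'"
      using F A' G by (intro exI[of _ "(F \<union> G, A')"]) (auto simp: Q_def s)
  qed
  then obtain s where s: "\<And>n. finite (fst (s n))" "\<And>n. Q n (s n) (s (Suc n))" by blast
  define F where "F = (\<lambda>n. fst (s n))"
  define A where "A = (\<lambda>n. snd (s n))"
  have A_step: "A (Suc n) \<subseteq> A n" and F_step: "F n \<subseteq> F (Suc n)"
    and block: "F (Suc n) - F n \<subseteq> A (Suc n)" "\<delta> \<le> \<mu> (F (Suc n) - F n)"
    and stable: "\<And>B. B \<subseteq> A (Suc n) \<Longrightarrow> rich B \<Longrightarrow>
      \<mu> (F n \<union> A (Suc n)) - 1 / real (Suc n) \<le> \<mu> (F n \<union> B)" for n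
    using s(2)[of n] unfolding Q_def F_def A_def by (auto simp: split_beta)
  have F_mono: "F m \<subseteq> F n" if "m \<le> n" for m n using that F_step lift_Suc_mono_le[of F] by blast
  have A_anti: "A n \<subseteq> A m" if "m \<le> n" for m n
    using that A_step lift_Suc_antimono_le[of A] by blast
  define U where "U = (\<Union>n. F n)"
  define G where "G = (\<lambda>n. F (Suc n) - F n)"
  have leave: "eventually (\<lambda>n. \<gamma> \<notin> G n) sequentially" for \<gamma>
  proof (cases "\<gamma> \<in> U")
    case True
    then obtain N where "\<gamma> \<in> F N" by (auto simp: U_def)
    then have "\<forall>n\<ge>N. \<gamma> \<notin> G n" using F_mono by (auto simp: G_def)
    then show ?thesis by (auto simp: eventually_sequentially)
  qed (auto simp: G_def U_def)
  have tail_rich: "rich (U - F n)" for n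
    unfolding rich_def
  proof (intro allI impI)
    fix H :: "'a set" assume H: "finite H"
    have "eventually (\<lambda>i. (\<forall>\<gamma>\<in>H. \<gamma> \<notin> G i) \<and> n \<le> i) sequentially"
      using leave H by (intro eventually_conj eventually_ball_finite eventually_ge_at_top) auto
    then obtain i where i: "\<forall>\<gamma>\<in>H. \<gamma> \<notin> G i" "n \<le> i" by (auto simp: eventually_sequentially)
    have "finite (G i)" using s(1) by (simp add: G_def F_def)
    moreover have "G i \<subseteq> U - F n - H" using i F_mono[OF i(2)] by (auto simp: G_def U_def)
    ultimately show "\<exists>K. finite K \<and> K \<subseteq> U - F n - H \<and> \<delta> \<le> \<mu> K"
      using block(2)[of i] by (auto simp: G_def)
  qed
  \<comment> \<open>A point outside \<open>F n\<close> enters with some later block, and these blocks lie in \<open>A (Suc n)\<close>.\<close>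
  have tail: "U - F n \<subseteq> A (Suc n)" for n
  proof
    fix \<gamma> assume \<gamma>: "\<gamma> \<in> U - F n"
    then obtain k where "\<gamma> \<in> F k" by (auto simp: U_def)
    then have "\<exists>i. \<gamma> \<notin> F i \<and> \<gamma> \<in> F (Suc i) \<and> n \<le> i"
    proof (induction k)
      case 0
      then show ?case using \<gamma> F_mono[of 0 n] by auto
    next
      case (Suc k)
      show ?case
      proof (cases "\<gamma> \<in> F k")
        case False
        then have "n \<le> k" using Suc.prems \<gamma> F_mono[of "Suc k" n] by (auto simp: not_less_eq_eq[symmetric])
        then show ?thesis using False Suc.prems by blast
      qed (rule Suc.IH)
    qed
    then obtain i where "\<gamma> \<in> F (Suc i) - F i" "n \<le> i" by blast
    then show "\<gamma> \<in> A (Suc n)" using block(1)[of i] A_anti[of "Suc n" "Suc i"] by auto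
  qed
  have bounds: "\<mu> U - 1 / real (Suc n) \<le> \<mu> (U - G n)" "\<mu> (U - G n) \<le> \<mu> U" for n
  proof -
    have U: "U = F n \<union> (U - F n)" by (auto simp: U_def)
    have rest: "U - G n = F n \<union> (U - F (Suc n))" using F_step[of n] by (auto simp: U_def G_def)
    have "U - F (Suc n) \<subseteq> A (Suc n)" using tail[of n] F_step[of n] by blast
    from stable[OF this tail_rich]
    have "\<mu> (F n \<union> A (Suc n)) - 1 / real (Suc n) \<le> \<mu> (U - G n)" by (simp only: rest)
    moreover have "\<mu> U \<le> \<mu> (F n \<union> A (Suc n))" using U tail[of n] by (intro \<mu>_mono) blast
    ultimately show "\<mu> U - 1 / real (Suc n) \<le> \<mu> (U - G n)" by simp
    show "\<mu> (U - G n) \<le> \<mu> U" by (rule \<mu>_mono) blast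
  qed
  have "(\<lambda>n. nrm E (coord_restrict (U - G n) x - coord_restrict U x)) \<longlonglongrightarrow> 0"
  proof (rule kadets_klee_pointwise_nonnormalised[OF E kk bss_coord_restrict(1)[OF E x] bss_coord_restrict(1)[OF E x]])
    have "(\<lambda>n. \<mu> U - 1 / real (Suc n)) \<longlonglongrightarrow> \<mu> U - 0"
      by (intro tendsto_intros LIMSEQ_Suc[OF lim_1_over_n])
    then have "(\<lambda>n. \<mu> U - 1 / real (Suc n)) \<longlonglongrightarrow> \<mu> U" by simp
    then have "(\<lambda>n. \<mu> (U - G n)) \<longlonglongrightarrow> \<mu> U"
      by (rule tendsto_sandwich[OF _ _ _ tendsto_const, rotated 2])
        (use bounds in \<open>auto intro!: always_eventually\<close>)
    then show "(\<lambda>n. nrm E (coord_restrict (U - G n) x)) \<longlonglongrightarrow> nrm E (coord_restrict U x)" by (simp only: \<mu>_def)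
    show "(\<lambda>n. coord_restrict (U - G n) x \<gamma>) \<longlonglongrightarrow> coord_restrict U x \<gamma>" for \<gamma>
      by (rule tendsto_eventually) (use leave[of \<gamma>] in \<open>rule eventually_mono\<close>, simp)
  qed
  moreover have "\<delta> \<le> nrm E (coord_restrict (U - G n) x - coord_restrict U x)" for n
  proof -
    have "coord_restrict U x - coord_restrict (U - G n) x = coord_restrict (G n) x"
      by (auto simp: fun_eq_iff G_def U_def)
    then show ?thesis
      using nrm_minus_commute[OF ns bss_coord_restrict(1)[OF E x] bss_coord_restrict(1)[OF E x], of "U - G n" U] block(2)[of n]
      by (simp add: \<mu>_def G_def)
  qed
  ultimately have "\<delta> \<le> 0" by (intro LIMSEQ_le_const) auto
  then show False using \<delta> by simp
qed

lemma kadets_klee_pointwise_imp_order_continuous: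
  assumes "countable \<Gamma>" "banach_sequence_space \<Gamma> E" "kadets_klee E (pointwise_topology E)"
    "x \<in> vecs E" "0 < \<epsilon>"
  shows "\<exists>F. finite F \<and> F \<subseteq> \<Gamma> \<and> nrm E (coord_restrict (\<Gamma> - F) x) < \<epsilon>"
  using bss_cauchy_imp_small_tails[OF assms(1,2,4) kadets_klee_pointwise_imp_cauchy[OF assms(2,3,4)] assms(5)] .

section \<open>Direct sums\<close>

lemma norm_fun_apply: "norm_fun \<Gamma> X x \<gamma> = (if \<gamma> \<in> \<Gamma> then nrm (X \<gamma>) (x \<gamma>) else 0)"
  by (simp add: norm_fun_def)

lemma direct_sum_vecs:
  "x \<in> vecs (direct_sum \<Gamma> X E) \<longleftrightarrow>
    (\<forall>\<gamma>\<in>\<Gamma>. x \<gamma> \<in> vecs (X \<gamma>)) \<and> (\<forall>\<gamma>. \<gamma> \<notin> \<Gamma> \<longrightarrow> x \<gamma> = 0) \<and> norm_fun \<Gamma> X x \<in> vecs E"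
  by (simp add: direct_sum_def)

lemma direct_sum_nrm: "nrm (direct_sum \<Gamma> X E) x = nrm E (norm_fun \<Gamma> X x)"
  by (simp add: direct_sum_def)

text \<open>
  The point is \<open>norm_fun \<Gamma> X (x + y) \<le> norm_fun \<Gamma> X x + norm_fun \<Gamma> X y\<close>: by the ideal
  property it gives both closure under addition and the triangle inequality.
\<close>
lemma normed_space_direct_sum:
  assumes XB: "\<forall>\<gamma>\<in>\<Gamma>. normed_space (X \<gamma>)" and E: "banach_sequence_space \<Gamma> E"
  shows "normed_space (direct_sum \<Gamma> X E)"
proof -
  note X = XB[rule_format]
  let ?D = "direct_sum \<Gamma> X E" and ?N = "norm_fun \<Gamma> X"
  note ns = bss_normed_space[OF E]
  have memD: "x \<gamma> \<in> vecs (X \<gamma>)" if "x \<in> vecs ?D" "\<gamma> \<in> \<Gamma>" for x \<gamma>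
    using that by (simp add: direct_sum_vecs)
  have NE: "?N x \<in> vecs E" if "x \<in> vecs ?D" for x using that by (simp add: direct_sum_vecs)
  have N0: "?N 0 = 0" by (rule ext) (simp add: norm_fun_apply nrm_zero[OF X])
  have Nscale: "?N (c *\<^sub>R x) = \<bar>c\<bar> *\<^sub>R ?N x" if "x \<in> vecs ?D" for c x
    by (rule ext) (simp add: norm_fun_apply nrm_scale[OF X memD[OF that]])
  have Nadd: "\<And>\<gamma>. \<bar>?N (x + y) \<gamma>\<bar> \<le> \<bar>(?N x + ?N y) \<gamma>\<bar>" if x: "x \<in> vecs ?D" and y: "y \<in> vecs ?D" for x y
  proof -
    fix \<gamma> show "\<bar>?N (x + y) \<gamma>\<bar> \<le> \<bar>(?N x + ?N y) \<gamma>\<bar>"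
    proof (cases "\<gamma> \<in> \<Gamma>")
      case True
      note n = X[OF True] memD[OF x True] memD[OF y True]
      show ?thesis
        using True nrm_triangle[OF n] nrm_nonneg[OF n(1,2)] nrm_nonneg[OF n(1,3)]
          nrm_nonneg[OF n(1) nspace_add[OF n]]
        by (simp add: norm_fun_apply)
    qed (simp add: norm_fun_apply)
  qed
  have "subspace (vecs ?D)"
  proof (rule subspaceI)
    show "0 \<in> vecs ?D"
      unfolding direct_sum_vecs N0 using nspace_zero[OF ns] nspace_zero[OF X] by simp
    show "c *\<^sub>R x \<in> vecs ?D" if x: "x \<in> vecs ?D" for c x
      unfolding direct_sum_vecs Nscale[OF x]
      using x nspace_scale[OF ns NE[OF x]] nspace_scale[OF X memD[OF x]] by (simp add: direct_sum_vecs)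
    show "x + y \<in> vecs ?D" if x: "x \<in> vecs ?D" and y: "y \<in> vecs ?D" for x y
    proof -
      have "?N (x + y) \<in> vecs E"
        by (rule bss_ideal(1)[OF E nspace_add[OF ns NE[OF x] NE[OF y]]]) (rule Nadd[OF x y])
      then show ?thesis
        using x y nspace_add[OF X memD[OF x] memD[OF y]] by (simp add: direct_sum_vecs)
    qed
  qed
  moreover have "nrm ?D x = 0 \<longleftrightarrow> x = 0" if x: "x \<in> vecs ?D" for x
  proof
    assume "nrm ?D x = 0"
    then have N: "?N x = 0" using nrm_eq_0_iff[OF ns NE[OF x]] by (simp add: direct_sum_nrm)
    show "x = 0"
    proof (rule ext)
      fix \<gamma> show "x \<gamma> = 0 \<gamma>"
        using fun_cong[OF N, of \<gamma>] x nrm_eq_0_iff[OF X memD[OF x], of \<gamma>]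
        by (cases "\<gamma> \<in> \<Gamma>") (simp_all add: norm_fun_apply direct_sum_vecs)
    qed
  qed (simp add: direct_sum_nrm N0 nrm_zero[OF ns])
  moreover have "nrm ?D (x + y) \<le> nrm ?D x + nrm ?D y" if x: "x \<in> vecs ?D" and y: "y \<in> vecs ?D" for x y
    unfolding direct_sum_nrm
    by (rule order_trans[OF bss_ideal(2)[OF E nspace_add[OF ns NE[OF x] NE[OF y]] Nadd[OF x y]]
          nrm_triangle[OF ns NE[OF x] NE[OF y]]])
  moreover have "nrm ?D (c *\<^sub>R x) = \<bar>c\<bar> * nrm ?D x" if x: "x \<in> vecs ?D" for c x
    unfolding direct_sum_nrm Nscale[OF x] by (simp add: nrm_scale[OF ns NE[OF x]])
  moreover have "0 \<le> nrm ?D x" if x: "x \<in> vecs ?D" for x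
    unfolding direct_sum_nrm by (rule nrm_nonneg[OF ns NE[OF x]])
  ultimately show ?thesis unfolding normed_space_def by simp
qed

definition single :: "'g \<Rightarrow> 'b \<Rightarrow> 'g \<Rightarrow> 'b::zero" where
  "single \<gamma> v = (\<lambda>i. if i = \<gamma> then v else 0)"

lemma norm_fun_single:
  assumes XB: "\<forall>\<gamma>\<in>\<Gamma>. normed_space (X \<gamma>)" and \<gamma>: "\<gamma> \<in> \<Gamma>"
  shows "norm_fun \<Gamma> X (single \<gamma> v) = nrm (X \<gamma>) v *\<^sub>R indicator {\<gamma>}"
  by (rule ext) (simp add: norm_fun_apply single_def nrm_zero[OF XB[rule_format]] \<gamma>)

lemma single_direct_sum:
  assumes XB: "\<forall>\<gamma>\<in>\<Gamma>. normed_space (X \<gamma>)" and E: "banach_sequence_space \<Gamma> E"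
    and \<gamma>: "\<gamma> \<in> \<Gamma>" and v: "v \<in> vecs (X \<gamma>)"
  shows "single \<gamma> v \<in> vecs (direct_sum \<Gamma> X E)"
    "nrm (direct_sum \<Gamma> X E) (single \<gamma> v) = nrm (X \<gamma>) v * nrm E (indicator {\<gamma>})"
proof -
  note X = XB[rule_format]
  have e: "indicator {\<gamma>} \<in> vecs E" using bss_indicator[OF E, of "{\<gamma>}"] \<gamma> by simp
  note ns = bss_normed_space[OF E]
  have "norm_fun \<Gamma> X (single \<gamma> v) \<in> vecs E"
    unfolding norm_fun_single[OF XB \<gamma>] by (rule nspace_scale[OF ns e])
  moreover have "single \<gamma> v i \<in> vecs (X i)" if "i \<in> \<Gamma>" for i
    using v nspace_zero[OF X[OF that]] by (simp add: single_def)
  ultimately show "single \<gamma> v \<in> vecs (direct_sum \<Gamma> X E)"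
    using \<gamma> by (auto simp: direct_sum_vecs single_def)
  show "nrm (direct_sum \<Gamma> X E) (single \<gamma> v) = nrm (X \<gamma>) v * nrm E (indicator {\<gamma>})"
    unfolding direct_sum_nrm norm_fun_single[OF XB \<gamma>]
    by (simp add: nrm_scale[OF ns e] nrm_nonneg[OF X[OF \<gamma>] v])
qed

text \<open>
  Coordinate maps are bounded because \<open>\<parallel>x \<gamma>\<parallel> e\<^sub>\<gamma>\<close> lies below \<open>norm_fun \<Gamma> X x\<close>.
\<close>
lemma coordinate_functional:
  assumes XB: "\<forall>\<gamma>\<in>\<Gamma>. normed_space (X \<gamma>)" and E: "banach_sequence_space \<Gamma> E"
    and \<gamma>: "\<gamma> \<in> \<Gamma>" and f: "f \<in> dual (X \<gamma>)"
  shows "(\<lambda>x. f (x \<gamma>)) \<in> dual (direct_sum \<Gamma> X E)"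
proof -
  note X = XB[rule_format]
  let ?D = "direct_sum \<Gamma> X E" and ?e = "nrm E (indicator {\<gamma>})"
  have mem: "x \<gamma> \<in> vecs (X \<gamma>)" if "x \<in> vecs ?D" for x using that \<gamma> by (simp add: direct_sum_vecs)
  obtain C where C: "0 \<le> C" "\<And>v. v \<in> vecs (X \<gamma>) \<Longrightarrow> \<bar>f v\<bar> \<le> C * nrm (X \<gamma>) v"
    using dual_bound[OF X[OF \<gamma>] f] by blast
  have "\<bar>f (x \<gamma>)\<bar> \<le> (C / ?e) * nrm ?D x" if x: "x \<in> vecs ?D" for x
  proof -
    have "norm_fun \<Gamma> X x \<in> vecs E" using x by (simp add: direct_sum_vecs)
    from bss_coordinate_le[OF E \<gamma> this]
    have "nrm (X \<gamma>) (x \<gamma>) * ?e \<le> nrm ?D x"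
      using \<gamma> nrm_nonneg[OF X[OF \<gamma>] mem[OF x]] by (simp add: norm_fun_apply direct_sum_nrm)
    then have "nrm (X \<gamma>) (x \<gamma>) \<le> nrm ?D x / ?e"
      using bss_unit_pos[OF E \<gamma>] by (simp add: field_simps)
    then have "C * nrm (X \<gamma>) (x \<gamma>) \<le> C * (nrm ?D x / ?e)" using C(1) by (rule mult_left_mono)
    then show ?thesis using C(2)[OF mem[OF x]] by simp
  qed
  moreover have "f ((x + y) \<gamma>) = f (x \<gamma>) + f (y \<gamma>)" if "x \<in> vecs ?D" "y \<in> vecs ?D" for x y
    using dual_add[OF f mem[OF that(1)] mem[OF that(2)]] by simp
  moreover have "f ((c *\<^sub>R x) \<gamma>) = c * f (x \<gamma>)" if "x \<in> vecs ?D" for c x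
    using dual_scale[OF f mem[OF that]] by simp
  ultimately show ?thesis unfolding dual_def by blast
qed

lemma single_functional:
  assumes XB: "\<forall>\<gamma>\<in>\<Gamma>. normed_space (X \<gamma>)" and E: "banach_sequence_space \<Gamma> E"
    and \<gamma>: "\<gamma> \<in> \<Gamma>" and g: "g \<in> dual (direct_sum \<Gamma> X E)"
  shows "(\<lambda>v. g (single \<gamma> v)) \<in> dual (X \<gamma>)"
proof -
  note X = XB[rule_format]
  let ?D = "direct_sum \<Gamma> X E"
  note S = single_direct_sum[OF XB E \<gamma>]
  obtain C where C: "\<And>x. x \<in> vecs ?D \<Longrightarrow> \<bar>g x\<bar> \<le> C * nrm ?D x"
    using dual_bound[OF normed_space_direct_sum[OF XB E] g] by blast
  have "\<bar>g (single \<gamma> v)\<bar> \<le> (C * nrm E (indicator {\<gamma>})) * nrm (X \<gamma>) v" if "v \<in> vecs (X \<gamma>)" for v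
    using C[OF S(1)[OF that]] S(2)[OF that] by (simp add: algebra_simps)
  moreover have "g (single \<gamma> (u + v)) = g (single \<gamma> u) + g (single \<gamma> v)"
    if "u \<in> vecs (X \<gamma>)" "v \<in> vecs (X \<gamma>)" for u v
  proof -
    have "single \<gamma> (u + v) = single \<gamma> u + single \<gamma> v" by (rule ext) (simp add: single_def)
    then show ?thesis using dual_add[OF g S(1)[OF that(1)] S(1)[OF that(2)]] by simp
  qed
  moreover have "g (single \<gamma> (c *\<^sub>R v)) = c * g (single \<gamma> v)" if "v \<in> vecs (X \<gamma>)" for c v
  proof -
    have "single \<gamma> (c *\<^sub>R v) = c *\<^sub>R single \<gamma> v" by (rule ext) (simp add: single_def)
    then show ?thesis using dual_scale[OF g S(1)[OF that]] by simp
  qed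
  ultimately show ?thesis unfolding dual_def by blast
qed

section \<open>Necessity of the conditions\<close>

lemma kadets_klee_direct_sum_imp_component:
  assumes XB: "\<forall>\<gamma>\<in>\<Gamma>. normed_space (X \<gamma>)" and E: "banach_sequence_space \<Gamma> E"
    and kk: "kadets_klee (direct_sum \<Gamma> X E) (weak_topology (direct_sum \<Gamma> X E))" and \<gamma>: "\<gamma> \<in> \<Gamma>"
  shows "kadets_klee (X \<gamma>) (weak_topology (X \<gamma>))"
  unfolding kadets_klee_def
proof (intro allI impI, elim conjE)
  note X = XB[rule_format]
  let ?D = "direct_sum \<Gamma> X E" and ?e = "nrm E (indicator {\<gamma>})"
  fix x l assume "\<forall>n. x n \<in> vecs (X \<gamma>) \<and> nrm (X \<gamma>) (x n) = 1"
    and l: "l \<in> vecs (X \<gamma>)" "nrm (X \<gamma>) l = 1" and lim: "limitin (weak_topology (X \<gamma>)) x l sequentially"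
  then have x: "\<And>n. x n \<in> vecs (X \<gamma>)" "\<And>n. nrm (X \<gamma>) (x n) = 1" by auto
  note S = single_direct_sum[OF XB E \<gamma>]
  have "(\<lambda>n. nrm ?D (single \<gamma> (x n) - single \<gamma> l)) \<longlonglongrightarrow> 0"
  proof (rule kadets_klee_weak_nonnormalised[OF normed_space_direct_sum[OF XB E] kk S(1)[OF x(1)] S(1)[OF l(1)]])
    show "(\<lambda>n. nrm ?D (single \<gamma> (x n))) \<longlonglongrightarrow> nrm ?D (single \<gamma> l)"
      by (simp add: S(2)[OF x(1)] S(2)[OF l(1)] x(2) l(2))
    show "(\<lambda>n. f (single \<gamma> (x n))) \<longlonglongrightarrow> f (single \<gamma> l)" if "f \<in> dual ?D" for f
      using lim[unfolded limitin_weak_topology_iff[where x = x, OF x(1) l(1)], rule_format,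
          OF single_functional[OF XB E \<gamma> that]] .
  qed
  moreover have "nrm ?D (single \<gamma> (x n) - single \<gamma> l) = nrm (X \<gamma>) (x n - l) * ?e" for n
  proof -
    have "single \<gamma> (x n) - single \<gamma> l = single \<gamma> (x n - l)" by (rule ext) (simp add: single_def)
    then show ?thesis using S(2)[OF nspace_diff[OF X[OF \<gamma>] x(1) l(1)]] by simp
  qed
  ultimately have "(\<lambda>n. nrm (X \<gamma>) (x n - l) * ?e / ?e) \<longlonglongrightarrow> 0 / ?e"
    using bss_unit_pos[OF E \<gamma>] by (intro tendsto_divide) simp_all
  then show "(\<lambda>n. nrm (X \<gamma>) (x n - l)) \<longlonglongrightarrow> 0" using bss_unit_pos[OF E \<gamma>] by simp
qed

text \<open>
  A failure of SM at \<open>\<gamma>\<close> means that the norm of \<open>E\<close> is constant on a segment in the direction of \<open>e\<^sub>\<gamma>\<close>.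
  A weakly null sequence of unit vectors of \<open>X \<gamma>\<close> can then oscillate in that coordinate without being
  noticed by the norm of the direct sum.
\<close>
lemma kadets_klee_direct_sum_imp_schur_or_SM:
  assumes XB: "\<forall>\<gamma>\<in>\<Gamma>. normed_space (X \<gamma>)"
    and nontrivial: "\<forall>\<gamma>\<in>\<Gamma>. \<exists>v\<in>vecs (X \<gamma>). v \<noteq> 0"
    and E: "banach_sequence_space \<Gamma> E"
    and kk: "kadets_klee (direct_sum \<Gamma> X E) (weak_topology (direct_sum \<Gamma> X E))" and \<gamma>: "\<gamma> \<in> \<Gamma>"
  shows "schur_property (X \<gamma>) \<or> SM \<Gamma> E \<gamma>"
proof (rule ccontr)
  note X = XB[rule_format]
  assume "\<not> ?thesis"
  then have not_schur: "\<not> schur_property (X \<gamma>)" and not_SM: "\<not> SM \<Gamma> E \<gamma>" by auto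
  let ?D = "direct_sum \<Gamma> X E" and ?e = "nrm E (indicator {\<gamma>})"
  note ns = bss_normed_space[OF E] and nsD = normed_space_direct_sum[OF XB E] and nsX = X[OF \<gamma>]
  note S = single_direct_sum[OF XB E \<gamma>]
  obtain x y where "x \<in> positive_cone \<Gamma> E" "y \<in> positive_cone \<Gamma> E"
    and xy: "\<And>i. i \<in> \<Gamma> \<Longrightarrow> i \<noteq> \<gamma> \<Longrightarrow> x i \<le> y i" "x \<gamma> < y \<gamma>" "nrm E y \<le> nrm E x"
    using not_SM unfolding SM_def not_less[symmetric] by auto
  then have x: "x \<in> vecs E" "\<And>i. i \<in> \<Gamma> \<Longrightarrow> 0 \<le> x i" and y: "y \<in> vecs E" "\<And>i. i \<in> \<Gamma> \<Longrightarrow> 0 \<le> y i"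
    by (auto simp: positive_cone_def)
  define s where "s = y \<gamma> - x \<gamma>"
  have s: "0 < s" using xy(2) by (simp add: s_def)
  \<comment> \<open>The norm is constant between \<open>x\<close> and \<open>x + s e\<^sub>\<gamma>\<close>, since \<open>x + s e\<^sub>\<gamma> \<le> y\<close> and \<open>\<parallel>y\<parallel> \<le> \<parallel>x\<parallel>\<close>.\<close>
  have flat: "nrm E a = nrm E x"
    if a: "\<And>i. i \<in> \<Gamma> \<Longrightarrow> x i \<le> a i" "\<And>i. i \<in> \<Gamma> \<Longrightarrow> i \<noteq> \<gamma> \<Longrightarrow> a i = x i" "a \<gamma> \<le> x \<gamma> + s"
      "\<And>i. i \<notin> \<Gamma> \<Longrightarrow> a i = 0" for a
  proof (rule antisym)
    have ay: "\<bar>a i\<bar> \<le> \<bar>y i\<bar>" for i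
    proof (cases "i \<in> \<Gamma>")
      case True
      then have "a i \<le> y i" using a(2,3) xy(1) by (cases "i = \<gamma>") (simp_all add: s_def)
      then show ?thesis using a(1)[OF True] x(2)[OF True] by simp
    qed (simp add: a(4))
    have aE: "a \<in> vecs E" by (rule bss_ideal(1)[OF E y(1) ay])
    show "nrm E a \<le> nrm E x" using bss_ideal(2)[OF E y(1) ay] xy(3) by simp
    have xa: "\<bar>x i\<bar> \<le> \<bar>a i\<bar>" for i
      using a(1)[of i] x(2)[of i] bss_outside[OF E x(1), of i] by (cases "i \<in> \<Gamma>") simp_all
    show "nrm E x \<le> nrm E a" by (rule bss_ideal(2)[OF E aE xa])
  qed
  have unit: "\<exists>v\<in>vecs (X i). nrm (X i) v = 1" if i: "i \<in> \<Gamma>" for i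
  proof -
    obtain v where v: "v \<in> vecs (X i)" "v \<noteq> 0" using bspec[OF nontrivial i] by auto
    have "nrm (X i) (inverse (nrm (X i) v) *\<^sub>R v) = 1"
      using nrm_nonneg[OF X[OF i] v(1)] nrm_eq_0_iff[OF X[OF i] v(1)] v(2)
      by (simp add: nrm_scale[OF X[OF i] v(1)])
    then show ?thesis using nspace_scale[OF X[OF i] v(1)] by blast
  qed
  then obtain b where b: "\<And>i. i \<in> \<Gamma> \<Longrightarrow> b i \<in> vecs (X i)" "\<And>i. i \<in> \<Gamma> \<Longrightarrow> nrm (X i) (b i) = 1"
    by metis
  define z where "z = (\<lambda>i. if i \<in> \<Gamma> then x i *\<^sub>R b i else 0)"
  have Nz: "norm_fun \<Gamma> X z = x"
  proof (rule ext)
    fix i show "norm_fun \<Gamma> X z i = x i"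
      using bss_outside[OF E x(1), of i] x(2)[of i] nrm_scale[OF X b(1), of i "x i"] b(2)[of i]
      by (cases "i \<in> \<Gamma>") (simp_all add: norm_fun_apply z_def)
  qed
  have z: "z \<in> vecs ?D"
    unfolding direct_sum_vecs Nz using x(1) nspace_scale[OF X b(1)] by (simp add: z_def)
  have p: "z \<gamma> \<in> vecs (X \<gamma>)" "nrm (X \<gamma>) (z \<gamma>) = x \<gamma>"
    using z \<gamma> fun_cong[OF Nz, of \<gamma>] by (simp_all add: direct_sum_vecs norm_fun_apply)
  obtain w where w: "\<And>n. w n \<in> vecs (X \<gamma>)" "\<And>n. nrm (X \<gamma>) (w n) = 1"
    "\<And>f. f \<in> dual (X \<gamma>) \<Longrightarrow> (\<lambda>n. f (w n)) \<longlonglongrightarrow> 0"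
    using not_schur_weakly_null_unit_sequence[OF nsX not_schur] by blast
  \<comment> \<open>As \<open>z \<gamma>\<close> is the midpoint of \<open>z \<gamma> + s w\<close> and \<open>z \<gamma> - s w\<close>, one of these has norm at least \<open>\<parallel>z \<gamma>\<parallel>\<close>.\<close>
  define t where "t = (\<lambda>n. if x \<gamma> \<le> nrm (X \<gamma>) (z \<gamma> + s *\<^sub>R w n) then s else - s)"
  have abs_t: "\<bar>t n\<bar> = s" for n using s by (simp add: t_def)
  have tw: "t n *\<^sub>R w n \<in> vecs (X \<gamma>)" "nrm (X \<gamma>) (t n *\<^sub>R w n) = s" for n
    using nspace_scale[OF nsX w(1)] nrm_scale[OF nsX w(1)] abs_t w(2) by simp_all
  have lower: "x \<gamma> \<le> nrm (X \<gamma>) (z \<gamma> + t n *\<^sub>R w n)" for n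
  proof (cases "x \<gamma> \<le> nrm (X \<gamma>) (z \<gamma> + s *\<^sub>R w n)")
    case False
    let ?v = "s *\<^sub>R w n"
    have v: "?v \<in> vecs (X \<gamma>)" by (rule nspace_scale[OF nsX w(1)])
    have "(z \<gamma> + ?v) + (z \<gamma> - ?v) = 2 *\<^sub>R z \<gamma>" by (simp add: scaleR_2)
    then have "2 * x \<gamma> \<le> nrm (X \<gamma>) (z \<gamma> + ?v) + nrm (X \<gamma>) (z \<gamma> - ?v)"
      using nrm_triangle[OF nsX nspace_add[OF nsX p(1) v] nspace_diff[OF nsX p(1) v]]
        nrm_scale[OF nsX p(1), of 2] p(2) by simp
    then show ?thesis using False by (simp add: t_def)
  qed (simp add: t_def)
  define u where "u = (\<lambda>n. z + single \<gamma> (t n *\<^sub>R w n))"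
  have u: "u n \<in> vecs ?D" for n unfolding u_def by (rule nspace_add[OF nsD z S(1)[OF tw(1)]])
  have nrm_u: "nrm ?D (u n) = nrm ?D z" for n
    unfolding direct_sum_nrm Nz
  proof (rule flat)
    have at: "norm_fun \<Gamma> X (u n) \<gamma> = nrm (X \<gamma>) (z \<gamma> + t n *\<^sub>R w n)"
      using \<gamma> by (simp add: norm_fun_apply u_def single_def)
    show off: "norm_fun \<Gamma> X (u n) i = x i" if "i \<in> \<Gamma>" "i \<noteq> \<gamma>" for i
      using that fun_cong[OF Nz, of i] by (simp add: norm_fun_apply u_def single_def)
    show "x i \<le> norm_fun \<Gamma> X (u n) i" if "i \<in> \<Gamma>" for i
      using that lower[of n] at off[of i] by (cases "i = \<gamma>") simp_all
    show "norm_fun \<Gamma> X (u n) \<gamma> \<le> x \<gamma> + s"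
      unfolding at using nrm_triangle[OF nsX p(1) tw(1)[of n]] tw(2)[of n] p(2) by simp
    show "norm_fun \<Gamma> X (u n) i = 0" if "i \<notin> \<Gamma>" for i using that by (simp add: norm_fun_apply)
  qed
  have "(\<lambda>n. nrm ?D (u n - z)) \<longlonglongrightarrow> 0"
  proof (rule kadets_klee_weak_nonnormalised[OF nsD kk u z])
    show "(\<lambda>n. nrm ?D (u n)) \<longlonglongrightarrow> nrm ?D z" by (simp add: nrm_u)
    fix f assume f: "f \<in> dual ?D"
    note g = single_functional[OF XB E \<gamma> f]
    have fu: "f (u n) - f z = t n * f (single \<gamma> (w n))" for n
      using dual_add[OF f z S(1)[OF tw(1)[of n]]] dual_scale[OF g w(1)[of n], of "t n"]
      by (simp add: u_def)
    have "(\<lambda>n. f (u n) - f z) \<longlonglongrightarrow> 0"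
    proof (rule Lim_null_comparison)
      show "eventually (\<lambda>n. norm (f (u n) - f z) \<le> s * \<bar>f (single \<gamma> (w n))\<bar>) sequentially"
        by (simp add: fu abs_mult abs_t)
      show "(\<lambda>n. s * \<bar>f (single \<gamma> (w n))\<bar>) \<longlonglongrightarrow> 0"
        using tendsto_mult_left[OF tendsto_rabs_zero[OF w(3)[OF g]], of s] by simp
    qed
    then show "(\<lambda>n. f (u n)) \<longlonglongrightarrow> f z" by (simp add: LIM_zero_iff)
  qed
  moreover have "nrm ?D (u n - z) = s * ?e" for n
    using S(2)[OF tw(1)[of n]] tw(2)[of n] by (simp add: u_def)
  ultimately have "s * ?e = 0" by (simp add: LIMSEQ_const_iff)
  then show False using s bss_unit_pos[OF E \<gamma>] by simp
qed

section \<open>Sufficiency of the conditions\<close>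

text \<open>
  Suppose that \<open>a n \<gamma> \<ge> c > l \<gamma>\<close> infinitely often, and let \<open>b\<close> be \<open>l\<close> with the value at \<open>\<gamma>\<close> raised to
  \<open>c\<close>. On a finite set \<open>b\<close> is then almost dominated by some \<open>a n\<close>, so its restriction to that
  set has norm at most slightly above 1. By order continuity \<open>\<parallel>b\<parallel> \<le> 1 = \<parallel>l\<parallel>\<close>, contrary to
  SM at \<open>\<gamma>\<close>.
\<close>
lemma SM_imp_coordinate_convergence:
  assumes \<Gamma>: "countable \<Gamma>" and E: "banach_sequence_space \<Gamma> E"
    and kk: "kadets_klee E (pointwise_topology E)" and SM: "SM \<Gamma> E \<gamma>" and \<gamma>: "\<gamma> \<in> \<Gamma>"
    and a: "\<And>n. a n \<in> positive_cone \<Gamma> E" "\<And>n. nrm E (a n) \<le> 1"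
    and l: "l \<in> positive_cone \<Gamma> E" "nrm E l = 1"
    and lsc: "\<And>i c. i \<in> \<Gamma> \<Longrightarrow> c < l i \<Longrightarrow> eventually (\<lambda>n. c < a n i) sequentially"
  shows "(\<lambda>n. a n \<gamma>) \<longlonglongrightarrow> l \<gamma>"
proof (rule order_tendstoI)
  show "eventually (\<lambda>n. c < a n \<gamma>) sequentially" if "c < l \<gamma>" for c by (rule lsc[OF \<gamma> that])
  fix c assume c: "l \<gamma> < c"
  note ns = bss_normed_space[OF E]
  have aE: "a n \<in> vecs E" "\<And>i. i \<in> \<Gamma> \<Longrightarrow> 0 \<le> a n i" for n
    using a(1)[of n] by (simp_all add: positive_cone_def)
  have lE: "l \<in> vecs E" "\<And>i. i \<in> \<Gamma> \<Longrightarrow> 0 \<le> l i" using l(1) by (simp_all add: positive_cone_def)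
  define b where "b = l + (c - l \<gamma>) *\<^sub>R indicator {\<gamma>}"
  have bE: "b \<in> vecs E"
    unfolding b_def using bss_indicator[OF E, of "{\<gamma>}"] \<gamma> lE(1) by (simp add: nspace_closed[OF ns])
  have b_at: "b \<gamma> = c" and b_off: "i \<noteq> \<gamma> \<Longrightarrow> b i = l i" for i
    by (simp_all add: b_def)
  have b_pos: "0 \<le> b i" if "i \<in> \<Gamma>" for i
    using c lE(2)[OF that] b_at b_off[of i] by (cases "i = \<gamma>") simp_all
  have "nrm E l < nrm E b"
    using SM l(1) bE b_pos b_at b_off c unfolding SM_def positive_cone_def by simp
  then have gap: "0 < nrm E b - 1" using l(2) by simp
  define \<eta> where "\<eta> = (nrm E b - 1) / 2"
  have "0 < \<eta>" using gap by (simp add: \<eta>_def)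
  obtain F where F: "finite F" "F \<subseteq> \<Gamma>" "nrm E (coord_restrict (\<Gamma> - F) b) < \<eta>"
    using kadets_klee_pointwise_imp_order_continuous[OF \<Gamma> E kk bE \<open>0 < \<eta>\<close>] by blast
  have FE: "indicator F \<in> vecs E" by (rule bss_indicator[OF E F(1,2)])
  define \<kappa> where "\<kappa> = \<eta> / (nrm E (indicator F) + 1)"
  have \<kappa>: "0 < \<kappa>" "\<kappa> * nrm E (indicator F) \<le> \<eta>"
    using \<open>0 < \<eta>\<close> nrm_nonneg[OF ns FE] by (simp_all add: \<kappa>_def field_simps)
  show "eventually (\<lambda>n. a n \<gamma> < c) sequentially"
  proof (rule ccontr)
    assume "\<not> ?thesis"
    then have "\<exists>\<^sub>F n in sequentially. \<not> a n \<gamma> < c" by (simp add: not_eventually)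
    moreover have "eventually (\<lambda>n. \<forall>i\<in>F. l i - \<kappa> < a n i) sequentially"
    proof (rule eventually_ball_finite[OF F(1)], rule ballI)
      fix i assume "i \<in> F"
      then show "eventually (\<lambda>n. l i - \<kappa> < a n i) sequentially"
        using F(2) \<kappa>(1) by (intro lsc) auto
    qed
    ultimately have "\<exists>\<^sub>F n in sequentially. \<not> a n \<gamma> < c \<and> (\<forall>i\<in>F. l i - \<kappa> < a n i)"
      by (rule frequently_eventually_frequently)
    then obtain n where "\<not> a n \<gamma> < c \<and> (\<forall>i\<in>F. l i - \<kappa> < a n i)"
      by (blast dest: frequently_ex)
    then have n: "c \<le> a n \<gamma>" "\<And>i. i \<in> F \<Longrightarrow> l i - \<kappa> < a n i" by auto
    have dominated: "\<bar>coord_restrict F b i\<bar> \<le> \<bar>(a n + \<kappa> *\<^sub>R indicator F) i\<bar>" for i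
    proof (cases "i \<in> F")
      case True
      have "b i \<le> a n i + \<kappa>"
        using n(1) n(2)[OF True] \<kappa>(1) b_at b_off[of i] by (cases "i = \<gamma>") simp_all
      then show ?thesis using True F(2) b_pos[of i] aE(2)[of i n] \<kappa>(1) by auto
    qed simp
    have "nrm E (coord_restrict F b) \<le> nrm E (a n + \<kappa> *\<^sub>R indicator F)"
      by (rule bss_ideal(2)[OF E nspace_add[OF ns aE(1) nspace_scale[OF ns FE]] dominated])
    also have "\<dots> \<le> nrm E (a n) + \<kappa> * nrm E (indicator F)"
      using nrm_triangle[OF ns aE(1)[of n] nspace_scale[OF ns FE, of \<kappa>]] \<kappa>(1)
      by (simp add: nrm_scale[OF ns FE])
    also have "\<dots> \<le> 1 + \<eta>" using a(2)[of n] \<kappa>(2) by simp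
    finally have head: "nrm E (coord_restrict F b) \<le> 1 + \<eta>" .
    have "coord_restrict F b + coord_restrict (\<Gamma> - F) b = b"
    proof (rule ext)
      fix i show "(coord_restrict F b + coord_restrict (\<Gamma> - F) b) i = b i"
        using bss_outside[OF E bE, of i] by simp
    qed
    then have "nrm E b \<le> nrm E (coord_restrict F b) + nrm E (coord_restrict (\<Gamma> - F) b)"
      using nrm_triangle[OF ns bss_coord_restrict(1)[OF E bE] bss_coord_restrict(1)[OF E bE], of F "\<Gamma> - F"] by simp
    then have "nrm E b < 1 + \<eta> + \<eta>" using head F(3) by simp
    then show False by (simp add: \<eta>_def)
  qed
qed

text \<open>
  A dominated convergence principle. On a finite set \<open>d n\<close> is uniformly small, and off a large
  finite set the fixed part \<open>a\<close> of the bound is small by order continuity.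
\<close>
lemma dominated_pointwise_null_imp_norm_null:
  assumes \<Gamma>: "countable \<Gamma>" and E: "banach_sequence_space \<Gamma> E"
    and kk: "kadets_klee E (pointwise_topology E)"
    and d: "\<And>n. d n \<in> vecs E" "\<And>i. (\<lambda>n. d n i) \<longlonglongrightarrow> 0"
    and h: "\<And>n. h n \<in> vecs E" "(\<lambda>n. nrm E (h n)) \<longlonglongrightarrow> 0" and a: "a \<in> vecs E"
    and bound: "\<And>n i. \<bar>d n i\<bar> \<le> \<bar>h n i\<bar> + \<bar>a i\<bar>"
  shows "(\<lambda>n. nrm E (d n)) \<longlonglongrightarrow> 0"
proof (rule tendstoI)
  fix \<epsilon> :: real assume \<epsilon>: "0 < \<epsilon>"
  note ns = bss_normed_space[OF E]
  have "0 < \<epsilon> / 3" using \<epsilon> by simp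
  then obtain F where F: "finite F" "F \<subseteq> \<Gamma>" "nrm E (coord_restrict (\<Gamma> - F) a) < \<epsilon> / 3"
    using kadets_klee_pointwise_imp_order_continuous[OF \<Gamma> E kk a] by blast
  have FE: "indicator F \<in> vecs E" by (rule bss_indicator[OF E F(1,2)])
  define \<kappa> where "\<kappa> = \<epsilon> / 3 / (nrm E (indicator F) + 1)"
  have \<kappa>: "0 < \<kappa>" "\<kappa> * nrm E (indicator F) \<le> \<epsilon> / 3"
    using \<epsilon> nrm_nonneg[OF ns FE] by (simp_all add: \<kappa>_def field_simps)
  have "eventually (\<lambda>n. \<forall>i\<in>F. \<bar>d n i\<bar> < \<kappa>) sequentially"
  proof (rule eventually_ball_finite[OF F(1)], rule ballI)
    show "eventually (\<lambda>n. \<bar>d n i\<bar> < \<kappa>) sequentially" for i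
      using order_tendstoD(2)[OF tendsto_rabs_zero[OF d(2)[of i]] \<kappa>(1)] .
  qed
  moreover have "eventually (\<lambda>n. nrm E (h n) < \<epsilon> / 3) sequentially"
    by (rule order_tendstoD(2)[OF h(2) \<open>0 < \<epsilon> / 3\<close>])
  ultimately show "eventually (\<lambda>n. dist (nrm E (d n)) 0 < \<epsilon>) sequentially"
  proof eventually_elim
    case (elim n)
    define h' a' where "h' = (\<lambda>i. \<bar>h n i\<bar>)" and "a' = (\<lambda>i. \<bar>coord_restrict (\<Gamma> - F) a i\<bar>)"
    have h': "h' \<in> vecs E" "nrm E h' \<le> nrm E (h n)"
      using bss_ideal[OF E h(1)[of n], of h'] by (simp_all add: h'_def)
    have a': "a' \<in> vecs E" "nrm E a' \<le> nrm E (coord_restrict (\<Gamma> - F) a)"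
      using bss_ideal[OF E bss_coord_restrict(1)[OF E a, of "\<Gamma> - F"], of a'] by (simp_all add: a'_def)
    note m = nspace_scale[OF ns FE, of \<kappa>] nspace_add[OF ns h'(1) a'(1)]
    have dominated: "\<bar>d n i\<bar> \<le> \<bar>(\<kappa> *\<^sub>R indicator F + (h' + a')) i\<bar>" for i
    proof (cases "i \<in> F")
      case True
      then have "\<bar>d n i\<bar> < \<kappa>" using elim by blast
      moreover have "0 \<le> h' i" "0 \<le> a' i" by (simp_all add: h'_def a'_def)
      ultimately show ?thesis using True by simp
    next
      case False
      have "i \<notin> \<Gamma> \<Longrightarrow> a i = 0" by (rule bss_outside[OF E a])
      then show ?thesis using bound[of n i] False by (cases "i \<in> \<Gamma>") (simp_all add: h'_def a'_def)
    qed
    have "nrm E (d n) \<le> nrm E (\<kappa> *\<^sub>R indicator F + (h' + a'))"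
      by (rule bss_ideal(2)[OF E nspace_add[OF ns m] dominated])
    also have "\<dots> \<le> \<kappa> * nrm E (indicator F) + (nrm E h' + nrm E a')"
      using nrm_triangle[OF ns m] nrm_triangle[OF ns h'(1) a'(1)] \<kappa>(1)
      by (simp add: nrm_scale[OF ns FE])
    also have "\<dots> < \<epsilon>" using \<kappa>(2) h'(2) a'(2) elim F(3) by linarith
    finally show ?case using nrm_nonneg[OF ns d(1)] by simp
  qed
qed

lemma kadets_klee_direct_sumI:
  assumes \<Gamma>: "countable \<Gamma>" and XB: "\<forall>\<gamma>\<in>\<Gamma>. normed_space (X \<gamma>)"
    and E: "banach_sequence_space \<Gamma> E" and kk: "kadets_klee E (pointwise_topology E)"
    and kkX: "\<forall>\<gamma>\<in>\<Gamma>. kadets_klee (X \<gamma>) (weak_topology (X \<gamma>))"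
    and cases: "\<forall>\<gamma>\<in>\<Gamma>. schur_property (X \<gamma>) \<or> SM \<Gamma> E \<gamma>"
  shows "kadets_klee (direct_sum \<Gamma> X E) (weak_topology (direct_sum \<Gamma> X E))"
  unfolding kadets_klee_def
proof (intro allI impI, elim conjE)
  note X = XB[rule_format]
  let ?D = "direct_sum \<Gamma> X E" and ?N = "norm_fun \<Gamma> X"
  note ns = bss_normed_space[OF E] and nsD = normed_space_direct_sum[OF XB E]
  fix x l assume "\<forall>n. x n \<in> vecs ?D \<and> nrm ?D (x n) = 1"
    and l: "l \<in> vecs ?D" "nrm ?D l = 1" and lim: "limitin (weak_topology ?D) x l sequentially"
  then have x: "\<And>n. x n \<in> vecs ?D" "\<And>n. nrm ?D (x n) = 1" by auto
  have mem: "v \<gamma> \<in> vecs (X \<gamma>)" if "v \<in> vecs ?D" "\<gamma> \<in> \<Gamma>" for v \<gamma>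
    using that by (simp add: direct_sum_vecs)
  have weak: "(\<lambda>n. f (x n \<gamma>)) \<longlonglongrightarrow> f (l \<gamma>)" if "\<gamma> \<in> \<Gamma>" "f \<in> dual (X \<gamma>)" for \<gamma> f
    using lim[unfolded limitin_weak_topology_iff[where x = x, OF x(1) l(1)], rule_format,
        OF coordinate_functional[OF XB E that]] .
  have NE: "?N v \<in> vecs E" if "v \<in> vecs ?D" for v using that by (simp add: direct_sum_vecs)
  have Npos: "?N v \<in> positive_cone \<Gamma> E" if v: "v \<in> vecs ?D" for v
    using NE[OF v] nrm_nonneg[OF X mem[OF v]] by (simp add: positive_cone_def norm_fun_apply)
  have coord: "(\<lambda>n. ?N (x n) \<gamma>) \<longlonglongrightarrow> ?N l \<gamma>" for \<gamma>
  proof (cases "\<gamma> \<in> \<Gamma>")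
    case True
    show ?thesis
      using bspec[OF cases True]
    proof
      assume "schur_property (X \<gamma>)"
      then have conv: "(\<lambda>n. nrm (X \<gamma>) (x n \<gamma> - l \<gamma>)) \<longlonglongrightarrow> 0"
        by (rule schur_property_imp_norm_convergent[OF X[OF True] _ mem[OF l(1) True] mem[OF x(1) True]])
          (rule weak[OF True])
      have "(\<lambda>n. nrm (X \<gamma>) (x n \<gamma>) - nrm (X \<gamma>) (l \<gamma>)) \<longlonglongrightarrow> 0"
      proof (rule Lim_null_comparison[OF always_eventually conv], rule allI)
        fix n
        note m = mem[OF x(1) True, of n] mem[OF l(1) True]
        show "norm (nrm (X \<gamma>) (x n \<gamma>) - nrm (X \<gamma>) (l \<gamma>)) \<le> nrm (X \<gamma>) (x n \<gamma> - l \<gamma>)"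
          using nrm_triangle_diff[OF X[OF True] m] nrm_triangle_diff[OF X[OF True] m(2,1)]
            nrm_minus_commute[OF X[OF True] m]
          unfolding real_norm_def by linarith
      qed
      then show ?thesis using True by (simp add: norm_fun_apply LIM_zero_iff)
    next
      assume "SM \<Gamma> E \<gamma>"
      show ?thesis
      proof (rule SM_imp_coordinate_convergence[OF \<Gamma> E kk \<open>SM \<Gamma> E \<gamma>\<close> True Npos[OF x(1)] _ Npos[OF l(1)]])
        show "nrm E (?N (x n)) \<le> 1" "nrm E (?N l) = 1" for n
          using x(2)[of n] l(2) by (simp_all add: direct_sum_nrm)
        show "eventually (\<lambda>n. c < ?N (x n) i) sequentially" if "i \<in> \<Gamma>" "c < ?N l i" for i c
          using weakly_convergent_norm_lsc[OF X[OF that(1)] mem[OF l(1) that(1)] mem[OF x(1) that(1)]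
              weak[OF that(1)], of c] that by (simp add: norm_fun_apply)
      qed
    qed
  qed (simp add: norm_fun_apply)
  have moduli: "(\<lambda>n. nrm E (?N (x n) - ?N l)) \<longlonglongrightarrow> 0"
    using x(2) l(2)
    by (intro kadets_klee_pointwise_nonnormalised[OF E kk NE[OF x(1)] NE[OF l(1)] _ coord])
      (simp add: direct_sum_nrm)
  have "(\<lambda>n. nrm E (?N (x n - l))) \<longlonglongrightarrow> 0"
  proof (rule dominated_pointwise_null_imp_norm_null[OF \<Gamma> E kk])
    show "?N (x n - l) \<in> vecs E" for n by (rule NE[OF nspace_diff[OF nsD x(1) l(1)]])
    show "?N (x n) - ?N l \<in> vecs E" for n by (rule nspace_diff[OF ns NE[OF x(1)] NE[OF l(1)]])
    show "(\<lambda>n. nrm E (?N (x n) - ?N l)) \<longlonglongrightarrow> 0" by (rule moduli)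
    show "2 *\<^sub>R ?N l \<in> vecs E" by (rule nspace_scale[OF ns NE[OF l(1)]])
    show "(\<lambda>n. ?N (x n - l) \<gamma>) \<longlonglongrightarrow> 0" for \<gamma>
    proof (cases "\<gamma> \<in> \<Gamma>")
      case True
      have "(\<lambda>n. nrm (X \<gamma>) (x n \<gamma> - l \<gamma>)) \<longlonglongrightarrow> 0"
      proof (rule kadets_klee_weak_nonnormalised[OF X[OF True] bspec[OF kkX True] mem[OF x(1) True] mem[OF l(1) True]])
        show "(\<lambda>n. nrm (X \<gamma>) (x n \<gamma>)) \<longlonglongrightarrow> nrm (X \<gamma>) (l \<gamma>)"
          using coord[of \<gamma>] True by (simp add: norm_fun_apply)
      qed (rule weak[OF True])
      then show ?thesis using True by (simp add: norm_fun_apply)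
    qed (simp add: norm_fun_apply)
    show "\<bar>?N (x n - l) \<gamma>\<bar> \<le> \<bar>(?N (x n) - ?N l) \<gamma>\<bar> + \<bar>(2 *\<^sub>R ?N l) \<gamma>\<bar>" for n \<gamma>
    proof (cases "\<gamma> \<in> \<Gamma>")
      case True
      note m = mem[OF x(1) True, of n] mem[OF l(1) True]
      have "nrm (X \<gamma>) (x n \<gamma> - l \<gamma>) \<le> nrm (X \<gamma>) (x n \<gamma>) + nrm (X \<gamma>) (l \<gamma>)"
        using nrm_triangle[OF X[OF True] m(1) nspace_scale[OF X[OF True] m(2), of "-1"]]
          nrm_scale[OF X[OF True] m(2), of "-1"] by simp
      then show ?thesis
        using True nrm_nonneg[OF X[OF True] nspace_diff[OF X[OF True] m]]
          nrm_nonneg[OF X[OF True] m(2)] by (simp add: norm_fun_apply)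
    qed (simp add: norm_fun_apply)
  qed
  then show "(\<lambda>n. nrm ?D (x n - l)) \<longlonglongrightarrow> 0" by (simp add: direct_sum_nrm)
qed

theorem theorem5p1p1:
  fixes \<Gamma> :: "'g set"
    and X :: "'g \<Rightarrow> ('b::real_vector) nspace"
    and E :: "('g \<Rightarrow> real) nspace"
  assumes "countable \<Gamma>"
    and "\<And>\<gamma>. \<gamma> \<in> \<Gamma> \<Longrightarrow> banach_space (X \<gamma>)"
    and "\<And>\<gamma>. \<gamma> \<in> \<Gamma> \<Longrightarrow> infinite_dimensional (X \<gamma>)"
    and "banach_sequence_space \<Gamma> E"
    and "kadets_klee E (pointwise_topology E)"
    and "monotone_complete \<Gamma> E"
  shows "kadets_klee (direct_sum \<Gamma> X E) (weak_topology (direct_sum \<Gamma> X E)) \<longleftrightarrow>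
    (\<forall>\<gamma>\<in>\<Gamma>. kadets_klee (X \<gamma>) (weak_topology (X \<gamma>))) \<and>
    (\<exists>\<Gamma>\<^sub>1 \<Gamma>\<^sub>2. \<Gamma>\<^sub>1 \<union> \<Gamma>\<^sub>2 = \<Gamma> \<and> \<Gamma>\<^sub>1 \<inter> \<Gamma>\<^sub>2 = {} \<and>
       (\<forall>\<gamma>\<in>\<Gamma>\<^sub>1. schur_property (X \<gamma>)) \<and> (\<forall>\<gamma>\<in>\<Gamma>\<^sub>2. SM \<Gamma> E \<gamma>))"
    (is "?kk \<longleftrightarrow> ?comp \<and> ?split")
proof -
  have X: "\<forall>\<gamma>\<in>\<Gamma>. normed_space (X \<gamma>)"
    using assms(2) by (simp add: banach_space_def)
  have nontrivial: "\<forall>\<gamma>\<in>\<Gamma>. \<exists>v\<in>vecs (X \<gamma>). v \<noteq> 0"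
    using infinite_dimensional_imp_nontrivial[OF bspec[OF X] assms(3)] by blast
  show ?thesis
  proof
    assume kk: ?kk
    have ?comp
      using kadets_klee_direct_sum_imp_component[OF X assms(4) kk] by blast
    moreover have ?split
    proof (intro exI conjI)
      let ?S = "{\<gamma> \<in> \<Gamma>. schur_property (X \<gamma>)}"
      show "?S \<union> (\<Gamma> - ?S) = \<Gamma>" "?S \<inter> (\<Gamma> - ?S) = {}" "\<forall>\<gamma>\<in>?S. schur_property (X \<gamma>)" by auto
      show "\<forall>\<gamma>\<in>\<Gamma> - ?S. SM \<Gamma> E \<gamma>"
        using kadets_klee_direct_sum_imp_schur_or_SM[OF X nontrivial assms(4) kk] by blast
    qed
    ultimately show "?comp \<and> ?split" ..
  next
    assume "?comp \<and> ?split"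
    then have ?comp "\<forall>\<gamma>\<in>\<Gamma>. schur_property (X \<gamma>) \<or> SM \<Gamma> E \<gamma>" by auto
    then show ?kk by (rule kadets_klee_direct_sumI[OF assms(1) X assms(4,5)])
  qed
qed

end
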